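(* Let $\xi$ be a bounded $\mathcal F_0$-measurable $C$-valued initial datum, and let $p>0$, $r>0$, $q>0$ be constants. Suppose that the following four conditions hold, with all constants independent of the step size $\Delta$. (i) For each step size $\Delta$ there is a continuous numerical solution $\{X(t;0,\xi)\}_{t\ge-\tau}$ approximating the solution of the SDDE, and its segment process $\{X_{t_k}^{0,\xi}\}_{k\in\mathbb N}$ is a time-homogeneous Markov chain. (ii) There is a positive constant $M_1$ such that $\mathbb E\big(|X(t;0,\xi)|^r\big)\le M_1$ for all $t\ge-\tau$. (iii) There are positive constants $M_2,M_3$ such that for every compact subset $K\subset C$, all $K$-valued initial data $\zeta,\eta$ and all $t\ge 0$, $$\mathbb E\big(|x(t;0,\zeta)-x(t;0,\eta)|^p\big)\le M_2\Big(\sup_{-\tau\le s\le 0}\mathbb E\big(|\zeta(s)-\eta(s)|^p\big)\Big)e^{-M_3t}.$$ (iv) For all grid times $0\le T_1<T_2$ there is a constant $C_{T_2-T_1}$, depending on $T_1,T_2$ only through $T_2-T_1$, such that for every bounded initial datum $\eta$ prescribed at time $T_1$, $$\sup_{T_1\le t\le T_2}\mathbb E\big(|x(t;T_1,\eta)-X(t;T_1,\eta)|^p\big)\le C_{T_2-T_1}\Big(1+\sup_{-\tau\le s\le 0}\mathbb E\big(|\eta(s)|^r\big)\Big)\Delta^q .$$ Then the numerical solution converges strongly to the solution of the SDDE in the infinite horizon: there is a positive constant $\mathcal K$, independent of $t$ and $\Delta$, such that for all $t\ge-\tau$ $$\mathbb E\big(|x(t;0,\xi)-X(t;0,\xi)|^p\big)\le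 \mathcal K\,\Delta^q .$$
   Context: Let $\tau>0$, $d,m\in\mathbb N_+$; $|\cdot|$ is the Euclidean norm on $\mathbb R^d$ (trace norm on $\mathbb R^{d\times m}$); $C=C([-\tau,0];\mathbb R^d)$ is the space of continuous functions with norm $\|X\|=\sup_{-\tau\le\theta\le0}|X(\theta)|$. $W$ is an $m$-dimensional Brownian motion on a probability space with right-continuous complete filtration $\{\mathcal F_t\}_{t\ge0}$. The stochastic delay differential equation (SDDE) is $$dx(t)=f(x(t),x(t-\tau))\,dt+g(x(t),x(t-\tau))\,dW(t),\quad t>0,\qquad x(\theta)=\xi(\theta),\ \theta\in[-\tau,0],$$ with $f:\mathbb R^d\times\mathbb R^d\to\mathbb R^d$ and $g:\mathbb R^d\times\mathbb R^d\to\mathbb R^{d\times m}$ Borel measurable; it is assumed to have a unique global solution. For $s\ge0$ and an $\mathcal F_s$-measurable $C$-valued random variable $\eta$, $x(t;s,\eta)$, $t\ge s-\tau$, is the solution started at time $s$ from $\eta$, i.e. $x(s+\theta;s,\eta)=\eta(\theta)$ for $\theta\in[-\tau,0]$, and $x_t^{s,\eta}(\theta)=x(t+\theta;s,\eta)$ is its segment process. The segment process is a homogeneous Markov process. Initial data are random, $C$-valued, and measurable with respect to the $\sigma$-algebra at the starting time; since the equation is autonomous, a solution started at time $s$ from an $\mathcal F_s$-measurable segment $\eta$ is regarded as a solution $x(\cdot;0,\eta)$ started at time $0$ (with shifted Brownian motion and filtration), and hypotheses on solutions started at time $0$ apply to such initial data. Step sizes are $\Delta=\tau/M$ with $M\in\mathbb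 N_+$; $t_k=k\Delta$ for $k\ge-M$; a grid time is an integer multiple of $\Delta$. A continuous numerical solution (for step size $\Delta$) is a continuous-in-time process $X(t;s,\eta)$, $t\ge s-\tau$, defined for starting grid times $s\ge0$ and $\mathcal F_s$-measurable $C$-valued $\eta$, with $X(s+\theta;s,\eta)=\eta(\theta)$ for $\theta\in[-\tau,0]$. Its segment is $X_t^{s,\eta}(\theta)=X(t+\theta;s,\eta)$, $\theta\in[-\tau,0]$. It has the flow property $X(t;0,\xi)=X(t;s,X_s^{0,\xi})$ for $0\le s<t$ with $s$ a grid time.
   Formalization: The numerical solution is additionally assumed to depend pathwise on its initial datum (data agreeing on an outcome give the same value there, a.s.); otherwise condition (iv), for bounded data only, need not control restarts from the unbounded numerical segment, and the claim is false. *)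

theory Defs
  imports "HOL-Probability.Probability"
begin

section \<open>The segment space $C([-\tau,0];R^d)$\<close>

text \<open>
  A continuous function on the interval from $-\tau$ to $0$ is represented by its constant
  extension to the whole line (\<^const>\<open>ext_cont\<close>), which is a bounded continuous function.  This
  is an isometry: the norm of \<^typ>\<open>real \<Rightarrow>\<^sub>C 'b::real_normed_vector\<close> on extended functions is the
  supremum over $[-\tau,0]$, so norm, compactness and Borel sets are the library ones.
\<close>

definition seg_set :: "real \<Rightarrow> (real \<Rightarrow>\<^sub>C 'b::euclidean_space) set" where
  "seg_set \<tau> = {\<phi>. ext_cont (apply_bcontfun \<phi>) (-\<tau>) 0 = apply_bcontfun \<phi>}"

definition seg_space :: "real \<Rightarrow> (real \<Rightarrow>\<^sub>C 'b::euclidean_space) measure" where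
  "seg_space \<tau> = restrict_space borel (seg_set \<tau>)"

definition segment ::
  "real \<Rightarrow> (real \<Rightarrow> 'a \<Rightarrow> 'b::euclidean_space) \<Rightarrow> real \<Rightarrow> 'a \<Rightarrow> (real \<Rightarrow>\<^sub>C 'b)" where
  "segment \<tau> y t \<omega> = Bcontfun (ext_cont (\<lambda>\<theta>. y (t + \<theta>) \<omega>) (-\<tau>) 0)"

section \<open>Stochastic basis and Brownian motion\<close>

text \<open>Only the times $t \ge 0$ of \<open>F\<close> are meaningful.\<close>

definition usual_filtration :: "'a measure \<Rightarrow> (real \<Rightarrow> 'a measure) \<Rightarrow> bool" where
  "usual_filtration M F \<longleftrightarrow>
     (\<forall>t\<ge>0. subalgebra M (F t)) \<and>
     (\<forall>s\<ge>0. \<forall>t\<ge>s. sets (F s) \<subseteq> sets (F t)) \<and>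
     (\<forall>t\<ge>0. (\<Inter>u\<in>{t<..}. sets (F u)) = sets (F t)) \<and>
     (\<forall>N\<in>null_sets M. \<forall>A\<subseteq>N. A \<in> sets (F 0))"

definition brownian_motion ::
  "'a measure \<Rightarrow> (real \<Rightarrow> 'a measure) \<Rightarrow> (real \<Rightarrow> 'a \<Rightarrow> real^'m) \<Rightarrow> bool" where
  "brownian_motion M F W \<longleftrightarrow>
     (\<forall>t\<ge>0. W t \<in> borel_measurable (F t)) \<and>
     (AE \<omega> in M. continuous_on {0..} (\<lambda>t. W t \<omega>)) \<and>
     (AE \<omega> in M. W 0 \<omega> = 0) \<and>
     (\<forall>s\<ge>0. \<forall>t>s.
        (\<forall>i. distributed M lborel (\<lambda>\<omega>. (W t \<omega> - W s \<omega>) $ i) (normal_density 0 (sqrt (t - s)))) \<and>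
        prob_space.indep_vars M (\<lambda>_. borel) (\<lambda>i \<omega>. (W t \<omega> - W s \<omega>) $ i) UNIV \<and>
        prob_space.indep_set M (sets (F s))
          {(\<lambda>\<omega>. W t \<omega> - W s \<omega>) -` B \<inter> space M | B. B \<in> sets borel})"

section \<open>The Ito integral\<close>

text \<open>
  A list with entries \<open>(a, b, \<Phi>)\<close> stands for the simple process
  $\sum \Phi\, 1_{(a,b]}$.
\<close>

type_synonym ('a, 'm, 'd) simple_proc = "(real \<times> real \<times> ('a \<Rightarrow> real^'m^'d)) list"

definition simple_proc ::
  "(real \<Rightarrow> 'a measure) \<Rightarrow> real \<Rightarrow> ('a, 'm::finite, 'd::finite) simple_proc \<Rightarrow> bool" where
  "simple_proc F s S \<longleftrightarrow> (\<forall>(a, b, \<Phi>)\<in>set S.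
     s \<le> a \<and> a \<le> b \<and> \<Phi> \<in> borel_measurable (F a) \<and> bounded (\<Phi> ` space (F a)))"

definition simple_val ::
  "('a, 'm::finite, 'd::finite) simple_proc \<Rightarrow> real \<Rightarrow> 'a \<Rightarrow> real^'m^'d" where
  "simple_val S u \<omega> = (\<Sum>(a, b, \<Phi>)\<leftarrow>S. indicator {a<..b} u *\<^sub>R \<Phi> \<omega>)"

definition simple_int ::
  "(real \<Rightarrow> 'a \<Rightarrow> real^'m) \<Rightarrow> ('a, 'm::finite, 'd::finite) simple_proc \<Rightarrow> real \<Rightarrow> 'a \<Rightarrow> real^'d" where
  "simple_int W S t \<omega> = (\<Sum>(a, b, \<Phi>)\<leftarrow>S. \<Phi> \<omega> *v (W (min b t) \<omega> - W (min a t) \<omega>))"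

text \<open>
  Measurability is part of the definition because \<^const>\<open>measure\<close> is $0$ on non-measurable sets.
\<close>

definition null_in_prob :: "'a measure \<Rightarrow> (nat \<Rightarrow> 'a \<Rightarrow> ennreal) \<Rightarrow> bool" where
  "null_in_prob M Z \<longleftrightarrow> (\<forall>n. Z n \<in> borel_measurable M) \<and>
     (\<forall>e>0. (\<lambda>n. measure M {\<omega>\<in>space M. ennreal e \<le> Z n \<omega>}) \<longlonglongrightarrow> 0)"

definition progressive ::
  "(real \<Rightarrow> 'a measure) \<Rightarrow> real \<Rightarrow> (real \<Rightarrow> 'a \<Rightarrow> 'b::topological_space) \<Rightarrow> bool" where
  "progressive F s G \<longleftrightarrow>
     (\<forall>t\<ge>s. (\<lambda>(u, \<omega>). G u \<omega>) \<in> borel_measurable (restrict_space borel {s..t} \<Otimes>\<^sub>M F t))"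

text \<open>
  \<open>ito_integral M F W s G I\<close>: the process \<open>I\<close> is (a continuous version of)
  $\int_s^t G(u)\,dW(u)$, $t \ge s$, for a progressive integrand \<open>G\<close> whose paths are almost surely
  locally square integrable.  As usual, the integral is the limit in probability of the integrals
  of simple processes approximating \<open>G\<close>.  The norm of \<^typ>\<open>real^'m^'d\<close> is the trace norm
  $\sqrt{\mathrm{trace}(A^T A)}$.
\<close>

definition ito_integral ::
  "'a measure \<Rightarrow> (real \<Rightarrow> 'a measure) \<Rightarrow> (real \<Rightarrow> 'a \<Rightarrow> real^'m) \<Rightarrow> real \<Rightarrow>
   (real \<Rightarrow> 'a \<Rightarrow> real^'m^'d) \<Rightarrow> (real \<Rightarrow> 'a \<Rightarrow> real^'d) \<Rightarrow> bool" where
  "ito_integral M F W s G I \<longleftrightarrow>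
     progressive F s G \<and>
     (AE \<omega> in M. \<forall>t\<ge>s. (\<integral>\<^sup>+u\<in>{s..t}. ennreal ((norm (G u \<omega>))\<^sup>2) \<partial>lborel) < \<infinity>) \<and>
     (\<forall>t\<ge>s. I t \<in> borel_measurable (F t)) \<and>
     (\<forall>\<omega>\<in>space M. continuous_on {s..} (\<lambda>t. I t \<omega>)) \<and>
     (\<exists>S. (\<forall>n. simple_proc F s (S n)) \<and>
       (\<forall>t\<ge>s.
         null_in_prob M (\<lambda>n \<omega>. \<integral>\<^sup>+u\<in>{s..t}. ennreal ((norm (simple_val (S n) u \<omega> - G u \<omega>))\<^sup>2) \<partial>lborel) \<and>
         null_in_prob M (\<lambda>n \<omega>. ennreal (norm (simple_int W (S n) t \<omega> - I t \<omega>)))))"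

section \<open>Stochastic delay differential equations\<close>

definition sdde_solution ::
  "'a measure \<Rightarrow> (real \<Rightarrow> 'a measure) \<Rightarrow> (real \<Rightarrow> 'a \<Rightarrow> real^'m) \<Rightarrow> real \<Rightarrow>
   (real^'d \<Rightarrow> real^'d \<Rightarrow> real^'d) \<Rightarrow> (real^'d \<Rightarrow> real^'d \<Rightarrow> real^'m^'d) \<Rightarrow>
   real \<Rightarrow> ('a \<Rightarrow> (real \<Rightarrow>\<^sub>C (real^'d))) \<Rightarrow> (real \<Rightarrow> 'a \<Rightarrow> real^'d) \<Rightarrow> bool" where
  "sdde_solution M F W \<tau> f g s \<eta> y \<longleftrightarrow>
     (\<forall>\<omega>\<in>space M. \<forall>\<theta>\<in>{-\<tau>..0}. y (s + \<theta>) \<omega> = apply_bcontfun (\<eta> \<omega>) \<theta>) \<and>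
     (\<forall>\<omega>\<in>space M. continuous_on {s - \<tau>..} (\<lambda>t. y t \<omega>)) \<and>
     (\<forall>t\<ge>s. y t \<in> borel_measurable (F t)) \<and>
     (AE \<omega> in M. \<forall>t\<ge>s. set_integrable lborel {s..t} (\<lambda>u. f (y u \<omega>) (y (u - \<tau>) \<omega>))) \<and>
     (\<exists>I. ito_integral M F W s (\<lambda>u \<omega>. g (y u \<omega>) (y (u - \<tau>) \<omega>)) I \<and>
       (AE \<omega> in M. \<forall>t\<ge>s.
          y t \<omega> = apply_bcontfun (\<eta> \<omega>) 0 + (LINT u:{s..t}|lborel. f (y u \<omega>) (y (u - \<tau>) \<omega>)) + I t \<omega>))"

text \<open>
  \<open>x s \<eta> t \<omega>\<close> is $x(t;s,\eta)(\omega)$; it is specified only for data \<open>\<eta>\<close> measurable at time \<open>s\<close>.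
\<close>

definition unique_sdde_solution ::
  "'a measure \<Rightarrow> (real \<Rightarrow> 'a measure) \<Rightarrow> (real \<Rightarrow> 'a \<Rightarrow> real^'m) \<Rightarrow> real \<Rightarrow>
   (real^'d \<Rightarrow> real^'d \<Rightarrow> real^'d) \<Rightarrow> (real^'d \<Rightarrow> real^'d \<Rightarrow> real^'m^'d) \<Rightarrow>
   (real \<Rightarrow> ('a \<Rightarrow> (real \<Rightarrow>\<^sub>C (real^'d))) \<Rightarrow> real \<Rightarrow> 'a \<Rightarrow> real^'d) \<Rightarrow> bool" where
  "unique_sdde_solution M F W \<tau> f g x \<longleftrightarrow>
     (\<forall>s\<ge>0. \<forall>\<eta> \<in> F s \<rightarrow>\<^sub>M seg_space \<tau>.
        sdde_solution M F W \<tau> f g s \<eta> (x s \<eta>) \<and>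
        (\<forall>y. sdde_solution M F W \<tau> f g s \<eta> y \<longrightarrow>
          (AE \<omega> in M. \<forall>t\<ge>s - \<tau>. y t \<omega> = x s \<eta> t \<omega>)))"

section \<open>Numerical solutions\<close>

text \<open>
  \<open>X s \<eta> t \<omega>\<close> is $X(t;s,\eta)(\omega)$, for starting times \<open>s\<close> on the grid of step size \<open>\<Delta>\<close>.
  Between grid times \<open>X\<close> need not be adapted (it may interpolate); the flow property only makes
  sense if the segments at grid times are.

  The last clause says that the initial datum enters pathwise: outcomes on which two data agree
  yield the same numerical trajectory.  For the exact solution this follows from uniqueness.  It is
  what allows an error estimate for bounded data to be used for the (in general unbounded) segments
  of the numerical solution itself.
\<close>

definition numerical_solution ::
  "'a measure \<Rightarrow> (real \<Rightarrow> 'a measure) \<Rightarrow> real \<Rightarrow> real \<Rightarrow>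
   (real \<Rightarrow> ('a \<Rightarrow> (real \<Rightarrow>\<^sub>C (real^'d))) \<Rightarrow> real \<Rightarrow> 'a \<Rightarrow> real^'d) \<Rightarrow> bool" where
  "numerical_solution M F \<tau> \<Delta> X \<longleftrightarrow>
     (\<forall>k::nat. \<forall>\<eta> \<in> F (real k * \<Delta>) \<rightarrow>\<^sub>M seg_space \<tau>.
        (\<forall>\<omega>\<in>space M. \<forall>\<theta>\<in>{-\<tau>..0}. X (real k * \<Delta>) \<eta> (real k * \<Delta> + \<theta>) \<omega> = apply_bcontfun (\<eta> \<omega>) \<theta>) \<and>
        (\<forall>\<omega>\<in>space M. continuous_on {real k * \<Delta> - \<tau>..} (\<lambda>t. X (real k * \<Delta>) \<eta> t \<omega>)) \<and>
        (\<forall>j\<ge>k. segment \<tau> (X (real k * \<Delta>) \<eta>) (real j * \<Delta>) \<in> F (real j * \<Delta>) \<rightarrow>\<^sub>M seg_space \<tau>)) \<and>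
     (\<forall>\<eta> \<in> F 0 \<rightarrow>\<^sub>M seg_space \<tau>. \<forall>k::nat. \<forall>t>real k * \<Delta>. AE \<omega> in M.
        X 0 \<eta> t \<omega> = X (real k * \<Delta>) (segment \<tau> (X 0 \<eta>) (real k * \<Delta>)) t \<omega>) \<and>
     (\<forall>k::nat. \<forall>\<eta> \<in> F (real k * \<Delta>) \<rightarrow>\<^sub>M seg_space \<tau>. \<forall>\<zeta> \<in> F (real k * \<Delta>) \<rightarrow>\<^sub>M seg_space \<tau>.
        \<forall>t\<ge>real k * \<Delta>. AE \<omega> in M. \<eta> \<omega> = \<zeta> \<omega> \<longrightarrow>
          X (real k * \<Delta>) \<eta> t \<omega> = X (real k * \<Delta>) \<zeta> t \<omega>)"

text \<open>Time-homogeneous Markov chain in state space \<open>S\<close>, with respect to its own past.\<close>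

definition homogeneous_markov_chain :: "'a measure \<Rightarrow> 's measure \<Rightarrow> (nat \<Rightarrow> 'a \<Rightarrow> 's) \<Rightarrow> bool" where
  "homogeneous_markov_chain M S Y \<longleftrightarrow>
     (\<forall>k. Y k \<in> M \<rightarrow>\<^sub>M S) \<and>
     (\<exists>\<kappa> \<in> S \<rightarrow>\<^sub>M prob_algebra S. \<forall>k. \<forall>A\<in>sets S. AE \<omega> in M.
        real_cond_exp M (sigma (space M) {Y i -` B \<inter> space M | i B. i \<le> k \<and> B \<in> sets S})
          (indicator (Y (Suc k) -` A \<inter> space M)) \<omega> = measure (\<kappa> (Y k \<omega>)) A)"

section \<open>Moments and bounded data\<close>

definition moment :: "'a measure \<Rightarrow> real \<Rightarrow> ('a \<Rightarrow> 'b::real_normed_vector) \<Rightarrow> ennreal" where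
  "moment M p Z = (\<integral>\<^sup>+\<omega>. ennreal (norm (Z \<omega>) powr p) \<partial>M)"

definition ess_bounded :: "'a measure \<Rightarrow> ('a \<Rightarrow> 'b::real_normed_vector) \<Rightarrow> bool" where
  "ess_bounded M Z \<longleftrightarrow> (\<exists>R. AE \<omega> in M. norm (Z \<omega>) \<le> R)"

end

theory Submission
  imports Defs "HOL-Complex_Analysis.Great_Picard"
begin

text \<open>
  Fix a time $T$ (a multiple of $\tau$, hence a grid time for every step size) so large that the
  contraction factor $2^p M_2 e^{-M_3 (T-\tau)}$ is at most $1/2$.  On $[kT,(k+1)T]$ insert the
  exact solution restarted at $kT$ from the numerical segment: the contraction estimate controls its
  distance to the exact solution, the finite-time error estimate its distance to the numerical one.
  If $E_k$ is the largest $p$-th moment of the error over $[kT-\tau,kT]$, then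
  $E_{k+1} \le E_k/2 + B\Delta^q$ and $E_0=0$, so that $E_k \le 2B\Delta^q$ for all $k$.

  The segments at time $kT$ are neither compactly supported nor bounded, so both estimates are
  applied to truncated data and passed to the limit by monotone convergence.  This uses tightness on
  the segment space and the locality of the exact solution in its initial datum, which follows
  from uniqueness by gluing two solutions along an event known at the starting time.
\<close>

section \<open>Compactness, measurability and tightness in the segment space\<close>

text \<open>The exact solution is restarted from the numerical segment, and not conversely, because
  the moment bound \<open>ii\<close> concerns the numerical solution: it turns the right-hand side
  of \<open>iv\<close>, which involves moments of the datum, into the same constant on every block.
  The contraction acts over \<open>T - \<tau>\<close> rather than \<open>T\<close> because the next
  error is a supremum over a whole segment, whose earliest time lies only \<open>T - \<tau>\<close>
  after the restart. The factor \<open>2 powr p\<close> comes from splitting the error in two and is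
  valid for \<open>p < 1\<close> as well. Truncated data are set to 0 off an event. This can only
  lower the right-hand sides of \<open>iii\<close> and \<open>iv\<close>, so the bounds are uniform
  in the truncation level and survive the limit. The event must be known at the starting time:
  multiplying the coefficients of a simple process by its indicator then keeps them adapted. The
  numerical solution is not given by an equation; its locality is the last clause of
  \<open>numerical_solution\<close>.\<close>

lemma clamp_Icc: "0 \<le> \<tau> \<Longrightarrow> clamp (-\<tau>) 0 x \<in> {-\<tau>..0}" for \<tau> x :: real
  using clamp_in_interval[of "-\<tau>" 0 x] by simp

lemma dist_apply_bcontfun_le: "dist (apply_bcontfun \<phi> x) (apply_bcontfun \<psi> x) \<le> dist \<phi> \<psi>"
  by (rule dist_bounded)

lemma continuous_on_eval_bcontfun: "continuous_on S (\<lambda>\<phi>. apply_bcontfun \<phi> x)"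
  unfolding continuous_on_iff using dist_apply_bcontfun_le le_less_trans by blast

lemma seg_set_iff:
  "\<phi> \<in> seg_set \<tau> \<longleftrightarrow> (\<forall>x. apply_bcontfun \<phi> (clamp (-\<tau>) 0 x) = apply_bcontfun \<phi> x)"
  by (auto simp: seg_set_def ext_cont_def fun_eq_iff)

lemma zero_in_seg_set: "0 \<in> seg_set \<tau>"
  by (simp add: seg_set_iff)

lemma closed_seg_set: "closed (seg_set \<tau> :: (real \<Rightarrow>\<^sub>C 'b::euclidean_space) set)"
proof -
  have "seg_set \<tau> = (\<Inter>x. {\<phi> :: real \<Rightarrow>\<^sub>C 'b. apply_bcontfun \<phi> (clamp (-\<tau>) 0 x) = apply_bcontfun \<phi> x})"
    by (auto simp: seg_set_iff)
  then show ?thesis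
    by (auto intro!: closed_Collect_eq continuous_on_eval_bcontfun)
qed

lemma dist_seg_le:
  assumes "0 \<le> \<tau>" "\<phi> \<in> seg_set \<tau>" "\<psi> \<in> seg_set \<tau>"
    and "\<And>\<theta>. \<theta> \<in> {-\<tau>..0} \<Longrightarrow> dist (apply_bcontfun \<phi> \<theta>) (apply_bcontfun \<psi> \<theta>) \<le> e"
  shows "dist \<phi> \<psi> \<le> e"
proof (rule dist_bound)
  fix x show "dist (apply_bcontfun \<phi> x) (apply_bcontfun \<psi> x) \<le> e"
    using assms(4)[OF clamp_Icc[OF assms(1), of x]] assms(2,3) by (simp add: seg_set_iff)
qed

lemma ext_cont_in_bcontfun:
  fixes h :: "real \<Rightarrow> 'b::euclidean_space"
  assumes "continuous_on {-\<tau>..0} h"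
  shows "ext_cont h (-\<tau>) 0 \<in> bcontfun"
proof -
  have c: "continuous_on (cbox (-\<tau>) 0) h" using assms by simp
  moreover have "bounded (h ` cbox (-\<tau>) 0)"
    using c by (intro compact_imp_bounded compact_continuous_image) auto
  ultimately show ?thesis
    using clamp_bounded[of h "-\<tau>" 0] continuous_on_ext_cont[of "-\<tau>" 0 h UNIV]
    by (simp add: bcontfun_def ext_cont_def)
qed

lemma apply_Bcontfun_ext_cont:
  fixes h :: "real \<Rightarrow> 'b::euclidean_space"
  assumes "continuous_on {-\<tau>..0} h"
  shows "apply_bcontfun (Bcontfun (ext_cont h (-\<tau>) 0)) = ext_cont h (-\<tau>) 0"
  by (rule Bcontfun_inverse[OF ext_cont_in_bcontfun[OF assms]])

lemma Bcontfun_ext_cont_in_seg_set: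
  fixes h :: "real \<Rightarrow> 'b::euclidean_space"
  assumes "0 \<le> \<tau>" "continuous_on {-\<tau>..0} h"
  shows "Bcontfun (ext_cont h (-\<tau>) 0) \<in> seg_set \<tau>"
  unfolding seg_set_iff apply_Bcontfun_ext_cont[OF assms(2)]
  using clamp_Icc[OF assms(1)] by (simp add: ext_cont_def)

lemma apply_Bcontfun_ext_cont_Icc:
  fixes h :: "real \<Rightarrow> 'b::euclidean_space"
  assumes "continuous_on {-\<tau>..0} h" "\<theta> \<in> {-\<tau>..0}"
  shows "apply_bcontfun (Bcontfun (ext_cont h (-\<tau>) 0)) \<theta> = h \<theta>"
  unfolding apply_Bcontfun_ext_cont[OF assms(1)] using assms(2) by (simp add: ext_cont_def)

section \<open>Arzela-Ascoli sets and separability of the segment space\<close>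

text \<open>The sequence \<open>\<delta>\<close> prescribes a modulus of continuity along the
  tolerances \<open>1 / real (Suc n)\<close>. Non-strict inequalities make the set closed. Ranging
  over all real \<open>s\<close>, \<open>t\<close> costs nothing, since segments are constant
  extensions and clamping is nonexpansive.\<close>

definition equicont_segs :: "real \<Rightarrow> (nat \<Rightarrow> real) \<Rightarrow> real \<Rightarrow> (real \<Rightarrow>\<^sub>C 'b::euclidean_space) set" where
  "equicont_segs \<tau> \<delta> R = {\<phi> \<in> seg_set \<tau>. norm \<phi> \<le> R \<and>
     (\<forall>n s t. dist s t \<le> \<delta> n \<longrightarrow> dist (apply_bcontfun \<phi> s) (apply_bcontfun \<phi> t) \<le> 1 / real (Suc n))}"

lemma closed_modulus_le:
  "closed {\<phi> :: real \<Rightarrow>\<^sub>C 'b::euclidean_space.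
     \<forall>s t. dist s t \<le> d \<longrightarrow> dist (apply_bcontfun \<phi> s) (apply_bcontfun \<phi> t) \<le> e}"
  by (intro closed_Collect_all closed_Collect_imp closed_Collect_le continuous_intros
      continuous_on_eval_bcontfun) auto

lemma closed_equicont_segs: "closed (equicont_segs \<tau> \<delta> R :: (real \<Rightarrow>\<^sub>C 'b::euclidean_space) set)"
proof -
  have "equicont_segs \<tau> \<delta> R = seg_set \<tau> \<inter> {\<phi> :: real \<Rightarrow>\<^sub>C 'b. norm \<phi> \<le> R} \<inter>
    (\<Inter>n. {\<phi>. \<forall>s t. dist s t \<le> \<delta> n \<longrightarrow> dist (apply_bcontfun \<phi> s) (apply_bcontfun \<phi> t) \<le> 1 / real (Suc n)})"
    by (auto simp: equicont_segs_def)
  then show ?thesis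
    by (auto intro!: closed_seg_set closed_modulus_le closed_Collect_le continuous_intros)
qed

text \<open>Arzela-Ascoli on \<open>{-\<tau>..0}\<close> yields a subsequence converging uniformly
  there. The constant extension of the limit is the limit in the segment space, and closedness keeps
  it in the set.\<close>

lemma compact_equicont_segs:
  assumes "0 \<le> \<tau>" "\<And>n. 0 < \<delta> n"
  shows "compact (equicont_segs \<tau> \<delta> R :: (real \<Rightarrow>\<^sub>C 'b::euclidean_space) set)"
  unfolding compact_eq_seq_compact_metric seq_compact_def
proof (intro allI impI)
  fix \<phi> :: "nat \<Rightarrow> real \<Rightarrow>\<^sub>C 'b" assume "\<forall>n. \<phi> n \<in> equicont_segs \<tau> \<delta> R"
  then have \<phi>: "\<phi> n \<in> equicont_segs \<tau> \<delta> R" for n by simp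
  have bd: "norm (apply_bcontfun (\<phi> n) x) \<le> R" for n x
    using norm_bounded[of "\<phi> n" x] \<phi>[of n] by (auto simp: equicont_segs_def)
  have ec: "\<exists>d>0. \<forall>n y. y \<in> {-\<tau>..0} \<and> norm (x - y) < d \<longrightarrow>
      norm (apply_bcontfun (\<phi> n) x - apply_bcontfun (\<phi> n) y) < e" if "0 < e" for x e :: real
  proof -
    obtain k where k: "1 / real (Suc k) < e"
      using \<open>0 < e\<close> nat_approx_posE by blast
    have "norm (apply_bcontfun (\<phi> n) x - apply_bcontfun (\<phi> n) y) < e" if "norm (x - y) < \<delta> k" for n y
    proof -
      have "dist (apply_bcontfun (\<phi> n) x) (apply_bcontfun (\<phi> n) y) \<le> 1 / real (Suc k)"
        using \<phi>[of n] that unfolding equicont_segs_def dist_norm by fastforce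
      with k show ?thesis by (simp add: dist_norm)
    qed
    with assms(2) show ?thesis by blast
  qed
  from Arzela_Ascoli[of "{-\<tau>..0}" "\<lambda>n. apply_bcontfun (\<phi> n)" R, OF _ bd ec]
  obtain g k where g: "continuous_on {-\<tau>..0} g" and k: "strict_mono (k :: nat \<Rightarrow> nat)"
    and lim: "\<And>e. 0 < e \<Longrightarrow> \<exists>N. \<forall>n x. n \<ge> N \<and> x \<in> {-\<tau>..0} \<longrightarrow> norm (apply_bcontfun (\<phi> (k n)) x - g x) < e"
    by auto
  define l where "l = Bcontfun (ext_cont g (-\<tau>) 0)"
  have l: "l \<in> seg_set \<tau>" and lg: "\<And>\<theta>. \<theta> \<in> {-\<tau>..0} \<Longrightarrow> apply_bcontfun l \<theta> = g \<theta>"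
    using Bcontfun_ext_cont_in_seg_set[OF assms(1) g] apply_Bcontfun_ext_cont_Icc[OF g]
    by (auto simp: l_def)
  have "(\<phi> \<circ> k) \<longlonglongrightarrow> l"
    unfolding lim_sequentially
  proof (intro allI impI)
    fix e :: real assume "0 < e"
    then obtain N where N: "\<forall>n x. n \<ge> N \<and> x \<in> {-\<tau>..0} \<longrightarrow> norm (apply_bcontfun (\<phi> (k n)) x - g x) < e/2"
      using lim[of "e/2"] by auto
    have "dist ((\<phi> \<circ> k) n) l < e" if "n \<ge> N" for n
    proof -
      have "dist (\<phi> (k n)) l \<le> e/2"
        using \<phi>[of "k n"] l N that
        by (intro dist_seg_le[OF assms(1)]) (auto simp: equicont_segs_def lg dist_norm less_imp_le)
      then show ?thesis using \<open>0 < e\<close> by simp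
    qed
    then show "\<exists>N. \<forall>n\<ge>N. dist ((\<phi> \<circ> k) n) l < e" by blast
  qed
  moreover from this have "l \<in> equicont_segs \<tau> \<delta> R"
    using closed_sequentially[OF closed_equicont_segs, of "\<phi> \<circ> k"] \<phi> by simp
  ultimately show "\<exists>l\<in>equicont_segs \<tau> \<delta> R. \<exists>r. strict_mono r \<and> (\<phi> \<circ> r) \<longlonglongrightarrow> l"
    using k by blast
qed

text \<open>Total boundedness gives a finite net of mesh \<open>1 / real (Suc n)\<close> for every
  \<open>n\<close>; their union is the dense set.\<close>

lemma compact_countable_dense:
  fixes K :: "'b::metric_space set"
  assumes "compact K"
  shows "\<exists>D\<subseteq>K. countable D \<and> (\<forall>x\<in>K. \<forall>e>0. \<exists>d\<in>D. dist x d < e)"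
proof -
  have "\<forall>n. \<exists>k\<subseteq>K. finite k \<and> K \<subseteq> (\<Union>x\<in>k. ball x (1 / real (Suc n)))"
    using seq_compact_imp_totally_bounded[of K] assms
    by (simp add: compact_eq_seq_compact_metric) (metis of_nat_Suc of_nat_0_less_iff zero_less_Suc zero_less_divide_1_iff)
  then obtain k where k: "\<And>n. k n \<subseteq> K" "\<And>n. finite (k n)" "\<And>n. K \<subseteq> (\<Union>x\<in>k n. ball x (1 / real (Suc n)))"
    by metis
  have "\<exists>d\<in>\<Union>(range k). dist x d < e" if "x \<in> K" "e > 0" for x e
  proof -
    obtain n where n: "1 / real (Suc n) < e" using \<open>0 < e\<close> nat_approx_posE by blast
    from k(3)[of n] that obtain d where "d \<in> k n" "dist d x < 1 / real (Suc n)" by auto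
    then show ?thesis using n by (auto simp: dist_commute intro!: bexI[of _ d])
  qed
  moreover have "countable (\<Union>(range k))" using k(2) by (auto intro: countable_finite)
  ultimately show ?thesis using k(1) by (intro exI[of _ "\<Union>(range k)"]) auto
qed

text \<open>Lipschitz functions are dense by the Weierstrass theorem, and those with a given bound form
  a compact set by the Arzela--Ascoli theorem.\<close>

lemma seg_set_countable_dense:
  assumes "0 \<le> \<tau>"
  shows "\<exists>D\<subseteq>seg_set \<tau> :: (real \<Rightarrow>\<^sub>C 'b::euclidean_space) set. countable D \<and>
    (\<forall>\<phi>\<in>seg_set \<tau>. \<forall>e>0. \<exists>\<psi>\<in>D. dist \<phi> \<psi> < e)"
proof -
  \<comment> \<open>The modulus is chosen so that a segment with Lipschitz constant at most
    \<open>real (Suc j)\<close> and norm at most \<open>real j\<close> lies in \<open>L j\<close>.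
    Below, \<open>j\<close> dominates both the bound of the derivative of the approximating
    polynomial and the norm of its extension.\<close>
  define L :: "nat \<Rightarrow> (real \<Rightarrow>\<^sub>C 'b) set"
    where "L j = equicont_segs \<tau> (\<lambda>n. 1 / (real (Suc j) * real (Suc n))) (real j)" for j
  have "\<forall>j. \<exists>D\<subseteq>L j. countable D \<and> (\<forall>x\<in>L j. \<forall>e>0. \<exists>d\<in>D. dist x d < e)"
    unfolding L_def by (intro allI compact_countable_dense compact_equicont_segs assms) auto
  then obtain D where D: "\<And>j. D j \<subseteq> L j" "\<And>j. countable (D j)"
      "\<And>j x e. x \<in> L j \<Longrightarrow> e > 0 \<Longrightarrow> \<exists>d\<in>D j. dist x d < e"
    by metis
  have "\<exists>\<psi>\<in>\<Union>(range D). dist \<phi> \<psi> < e" if \<phi>: "\<phi> \<in> seg_set \<tau>" and e: "0 < e" for \<phi> e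
  proof -
    obtain g where g: "polynomial_function g" "\<And>x. x \<in> {-\<tau>..0} \<Longrightarrow> norm (apply_bcontfun \<phi> x - g x) < e/2"
      using Stone_Weierstrass_polynomial_function[of "{-\<tau>..0}" "apply_bcontfun \<phi>" "e/2"] e by auto
    obtain g' where g': "polynomial_function g'" "\<And>x. (g has_vector_derivative g' x) (at x)"
      using has_vector_derivative_polynomial_function[OF g(1)] by blast
    have cg: "continuous_on {-\<tau>..0} g" and cg': "continuous_on {-\<tau>..0} g'"
      using g(1) g'(1) by (auto intro: continuous_on_polymonial_function)
    have "bounded (g' ` {-\<tau>..0})"
      using cg' by (intro compact_imp_bounded compact_continuous_image) auto
    then obtain B where B: "\<And>x. x \<in> {-\<tau>..0} \<Longrightarrow> norm (g' x) \<le> B"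
      unfolding bounded_iff by blast
    have lip: "dist (g s) (g t) \<le> B * dist s t" if "s \<in> {-\<tau>..0}" "t \<in> {-\<tau>..0}" for s t
      using differentiable_bound[of "{-\<tau>..0}" g "\<lambda>x h. h *\<^sub>R g' x" B s t] that B g'(2)
      by (auto simp: has_vector_derivative_def has_derivative_at_withinI onorm_scaleR_left
          onorm_id dist_norm)
    define \<psi> where "\<psi> = Bcontfun (ext_cont g (-\<tau>) 0)"
    have \<psi>: "\<psi> \<in> seg_set \<tau>" "\<And>\<theta>. \<theta> \<in> {-\<tau>..0} \<Longrightarrow> apply_bcontfun \<psi> \<theta> = g \<theta>"
        "apply_bcontfun \<psi> = ext_cont g (-\<tau>) 0"
      using Bcontfun_ext_cont_in_seg_set[OF assms(1) cg] apply_Bcontfun_ext_cont_Icc[OF cg]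
        apply_Bcontfun_ext_cont[OF cg] by (auto simp: \<psi>_def)
    obtain j :: nat where j: "max B (norm \<psi>) \<le> real j" using real_arch_simple by blast
    have "dist (apply_bcontfun \<psi> s) (apply_bcontfun \<psi> t) \<le> 1 / real (Suc n)"
      if "dist s t \<le> 1 / (real (Suc j) * real (Suc n))" for s t n
    proof -
      have "dist (apply_bcontfun \<psi> s) (apply_bcontfun \<psi> t)
          \<le> B * dist (clamp (-\<tau>) 0 s) (clamp (-\<tau>) 0 t)"
        unfolding \<psi>(3) ext_cont_def by (intro lip clamp_Icc assms)
      also have "\<dots> \<le> real (Suc j) * dist s t"
        using j by (intro mult_mono dist_clamps_le_dist_args) auto
      also have "\<dots> \<le> real (Suc j) * (1 / (real (Suc j) * real (Suc n)))"
        using that by (intro mult_left_mono) auto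
      finally show ?thesis by simp
    qed
    then have "\<psi> \<in> L j" using j \<psi>(1) by (auto simp: L_def equicont_segs_def)
    then obtain d where d: "d \<in> D j" "dist \<psi> d < e/2" using D(3) e by (meson half_gt_zero)
    have "dist \<phi> \<psi> \<le> e/2"
      using g(2) \<psi> \<phi> by (intro dist_seg_le[OF assms]) (auto simp: dist_norm less_imp_le)
    with d dist_triangle[of \<phi> d \<psi>] show ?thesis by (intro bexI[of _ d]) auto
  qed
  moreover have "\<Union>(range D) \<subseteq> seg_set \<tau>" using D(1) by (auto simp: L_def equicont_segs_def)
  moreover have "countable (\<Union>(range D))" using D(2) by auto
  ultimately show ?thesis by (intro exI[of _ "\<Union>(range D)"]) auto
qed

section \<open>Borel structure of the segment space\<close>

lemma space_seg_space: "space (seg_space \<tau>) = seg_set \<tau>"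
  by (simp add: seg_space_def space_restrict_space)

lemma measurable_eval_seg [measurable]:
  "(\<lambda>\<phi>. apply_bcontfun \<phi> x) \<in> borel_measurable (seg_space \<tau>)"
  unfolding seg_space_def
  by (intro measurable_restrict_space1 borel_measurable_continuous_onI continuous_on_eval_bcontfun)

lemma measurable_seg_space_borel: "Y \<in> N \<rightarrow>\<^sub>M seg_space \<tau> \<Longrightarrow> Y \<in> borel_measurable N"
  unfolding seg_space_def by (auto simp: measurable_restrict_space2_iff)

lemma measurable_seg_set:
  "Y \<in> N \<rightarrow>\<^sub>M seg_space \<tau> \<Longrightarrow> \<omega> \<in> space N \<Longrightarrow> Y \<omega> \<in> seg_set \<tau>"
  using measurable_space[of Y N "seg_space \<tau>" \<omega>] by (simp add: space_seg_space)

text \<open>The Borel sets of the segment space are generated by the evaluations because it is separable.\<close>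

lemma measurable_seg_spaceI:
  fixes Y :: "'a \<Rightarrow> real \<Rightarrow>\<^sub>C 'b::euclidean_space"
  assumes "0 \<le> \<tau>" and Y: "\<And>\<omega>. \<omega> \<in> space N \<Longrightarrow> Y \<omega> \<in> seg_set \<tau>"
    and meas: "\<And>\<theta>. \<theta> \<in> {-\<tau>..0} \<Longrightarrow> (\<lambda>\<omega>. apply_bcontfun (Y \<omega>) \<theta>) \<in> borel_measurable N"
  shows "Y \<in> N \<rightarrow>\<^sub>M seg_space \<tau>"
  unfolding seg_space_def
proof (intro measurable_restrict_space2 borel_measurableI)
  show "Y \<in> space N \<rightarrow> seg_set \<tau>" using Y by auto
  have [measurable]: "(\<lambda>\<omega>. apply_bcontfun (Y \<omega>) x) \<in> borel_measurable N" for x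
  proof -
    have "(\<lambda>\<omega>. apply_bcontfun (Y \<omega>) (clamp (-\<tau>) 0 x)) \<in> borel_measurable N"
      by (intro meas clamp_Icc assms)
    then show ?thesis
      by (rule measurable_cong[THEN iffD1, rotated]) (use Y seg_set_iff in blast)
  qed
  obtain D where D: "D \<subseteq> seg_set \<tau>" "countable D"
    "\<And>\<phi> e. \<phi> \<in> seg_set \<tau> \<Longrightarrow> 0 < e \<Longrightarrow> \<exists>\<psi>\<in>D. dist \<phi> (\<psi> :: real \<Rightarrow>\<^sub>C 'b) < e"
    using seg_set_countable_dense[OF assms(1)] by metis
  \<comment> \<open>Evaluations at rational points decide membership in a closed ball, because the
    distance of two segments at a point is continuous in that point. Only countably many conditions
    remain.\<close>
  have cball: "{\<omega> \<in> space N. dist d (Y \<omega>) \<le> r} \<in> sets N" for d :: "real \<Rightarrow>\<^sub>C 'b" and r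
  proof -
    have "dist d \<psi> \<le> r \<longleftrightarrow> (\<forall>x\<in>\<rat>. dist (apply_bcontfun d x) (apply_bcontfun \<psi> x) \<le> r)" for \<psi>
    proof
      assume "dist d \<psi> \<le> r"
      then show "\<forall>x\<in>\<rat>. dist (apply_bcontfun d x) (apply_bcontfun \<psi> x) \<le> r"
        using dist_apply_bcontfun_le order_trans by blast
    next
      assume *: "\<forall>x\<in>\<rat>. dist (apply_bcontfun d x) (apply_bcontfun \<psi> x) \<le> r"
      show "dist d \<psi> \<le> r"
      proof (rule dist_bound)
        fix x show "dist (apply_bcontfun d x) (apply_bcontfun \<psi> x) \<le> r"
        proof (rule continuous_le_on_closure[where S = "\<rat>" and f = "\<lambda>x. dist (apply_bcontfun d x) (apply_bcontfun \<psi> x)"])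
          show "continuous_on (closure \<rat>) (\<lambda>x. dist (apply_bcontfun d x) (apply_bcontfun \<psi> x))"
            by (intro continuous_intros) auto
          show "x \<in> closure \<rat>" unfolding Rats_closure_real ..
        qed (use * in blast)
      qed
    qed
    then have "{\<omega> \<in> space N. dist d (Y \<omega>) \<le> r} =
        {\<omega> \<in> space N. \<forall>x\<in>\<rat>. dist (apply_bcontfun d x) (apply_bcontfun (Y \<omega>) x) \<le> r}" by simp
    also have "\<dots> \<in> sets N"
      by (intro sets.sets_Collect_countable_All') (auto simp: countable_rat)
    finally show ?thesis .
  qed
  fix U :: "(real \<Rightarrow>\<^sub>C 'b) set" assume U: "open U"
  \<comment> \<open>Separability makes the open set, within the segments, a countable union of
    closed balls with centres in \<open>D\<close>. The radius below \<open>e/2\<close> keeps a ball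
    that contains \<open>Y \<omega>\<close> inside the \<open>e\<close>-ball around it.\<close>
  have "Y -` U \<inter> space N = (\<Union>d\<in>D. \<Union>k\<in>{k::nat. cball d (1 / real (Suc k)) \<subseteq> U}.
      {\<omega> \<in> space N. dist d (Y \<omega>) \<le> 1 / real (Suc k)})" (is "?L = ?R")
  proof
    show "?L \<subseteq> ?R"
    proof
      fix \<omega> assume \<omega>: "\<omega> \<in> ?L"
      then obtain e where e: "0 < e" "ball (Y \<omega>) e \<subseteq> U" using U by (auto simp: open_contains_ball)
      obtain k :: nat where k: "1 / real (Suc k) < e/2" using e(1) nat_approx_posE half_gt_zero by blast
      obtain d where d: "d \<in> D" "dist (Y \<omega>) d < 1 / real (Suc k)"
        using D(3)[of "Y \<omega>" "1 / real (Suc k)"] Y \<omega> by auto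
      have "cball d (1 / real (Suc k)) \<subseteq> ball (Y \<omega>) e"
      proof
        fix \<psi> assume "\<psi> \<in> cball d (1 / real (Suc k))"
        then have "dist d \<psi> \<le> 1 / real (Suc k)" by simp
        then show "\<psi> \<in> ball (Y \<omega>) e"
          using dist_triangle[of "Y \<omega>" \<psi> d] d(2) k unfolding mem_ball by linarith
      qed
      then show "\<omega> \<in> ?R" using d e(2) \<omega> by (auto simp: dist_commute less_imp_le intro!: bexI[of _ d] exI[of _ k])
    qed
    show "?R \<subseteq> ?L" by auto
  qed
  also have "\<dots> \<in> sets N" using D(2) cball by (intro sets.countable_UN'' countableI_type) auto
  finally show "Y -` U \<inter> space N \<in> sets N" .
qed

lemma segment_apply:
  assumes "continuous_on {t - \<tau>..t} (\<lambda>u. y u \<omega>)" "\<theta> \<in> {-\<tau>..0}"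
  shows "apply_bcontfun (segment \<tau> y t \<omega>) \<theta> = y (t + \<theta>) \<omega>"
proof -
  have "continuous_on {-\<tau>..0} (\<lambda>\<theta>. y (t + \<theta>) \<omega>)"
    by (rule continuous_on_compose2[OF assms(1)]) (auto intro!: continuous_intros)
  then show ?thesis unfolding segment_def using assms(2) by (rule apply_Bcontfun_ext_cont_Icc)
qed

lemma segment_in_seg_set:
  assumes "0 \<le> \<tau>" "continuous_on {t - \<tau>..t} (\<lambda>u. y u \<omega>)"
  shows "segment \<tau> y t \<omega> \<in> seg_set \<tau>"
proof -
  have "continuous_on {-\<tau>..0} (\<lambda>\<theta>. y (t + \<theta>) \<omega>)"
    by (rule continuous_on_compose2[OF assms(2)]) (auto intro!: continuous_intros)
  then show ?thesis unfolding segment_def by (rule Bcontfun_ext_cont_in_seg_set[OF assms(1)])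
qed

section \<open>Tightness of a random segment\<close>

text \<open>Uniform continuity on the compact interval passes to the whole line because clamping
  does not increase distances.\<close>

lemma seg_modulus:
  assumes "0 \<le> \<tau>" "\<phi> \<in> seg_set \<tau>" "0 < e"
  shows "\<exists>d>0. \<forall>s t. dist s t < d \<longrightarrow> dist (apply_bcontfun \<phi> s) (apply_bcontfun \<phi> t) < e"
proof -
  have "uniformly_continuous_on {-\<tau>..0} (apply_bcontfun \<phi>)"
    by (intro compact_uniformly_continuous) auto
  then obtain d where d: "0 < d" "\<And>s t. s \<in> {-\<tau>..0} \<Longrightarrow> t \<in> {-\<tau>..0} \<Longrightarrow> dist s t < d \<Longrightarrow>
      dist (apply_bcontfun \<phi> s) (apply_bcontfun \<phi> t) < e"
    using assms(3) unfolding uniformly_continuous_on_def by metis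
  have "dist (apply_bcontfun \<phi> s) (apply_bcontfun \<phi> t) < e" if "dist s t < d" for s t
    using d(2)[OF clamp_Icc[OF assms(1)] clamp_Icc[OF assms(1)], of s t] that
      dist_clamps_le_dist_args[of "-\<tau>" 0 s t] assms(2)[unfolded seg_set_iff] by simp
  with d(1) show ?thesis by blast
qed

text \<open>Every single path has finite norm and is uniformly continuous, so for fixed
  \<open>n\<close> the events \<open>E n j\<close>, on which level \<open>j\<close> fails for the
  norm or for the modulus at tolerance \<open>1 / real (Suc n)\<close>, decrease to the empty set.
  Choosing \<open>j m n\<close> with measure below \<open>(1/2) ^ (m + n)\<close> and summing over
  \<open>n\<close> leaves at most \<open>2 * (1/2) ^ m\<close> outside one equicontinuous
  set.\<close>

lemma (in finite_measure) seg_tight: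
  fixes \<zeta> :: "'a \<Rightarrow> real \<Rightarrow>\<^sub>C 'b::euclidean_space"
  assumes \<tau>: "0 \<le> \<tau>" and \<zeta>: "\<zeta> \<in> M \<rightarrow>\<^sub>M seg_space \<tau>"
  shows "\<exists>K :: nat \<Rightarrow> (real \<Rightarrow>\<^sub>C 'b) set. (\<forall>m. compact (K m) \<and> K m \<subseteq> seg_set \<tau>) \<and> incseq K \<and>
    (AE \<omega> in M. \<exists>m. \<zeta> \<omega> \<in> K m)"
proof -
  define G :: "nat \<Rightarrow> nat \<Rightarrow> (real \<Rightarrow>\<^sub>C 'b) set" where "G n j = {\<phi>. norm \<phi> \<le> real j} \<inter>
    {\<phi>. \<forall>s t. dist s t \<le> 1 / real (Suc j) \<longrightarrow> dist (apply_bcontfun \<phi> s) (apply_bcontfun \<phi> t) \<le> 1 / real (Suc n)}" for n j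
  have "closed (G n j)" for n j
    unfolding G_def by (intro closed_Int closed_modulus_le closed_Collect_le continuous_intros)
  then have [measurable]: "G n j \<in> sets borel" for n j by auto
  have \<zeta>b[measurable]: "\<zeta> \<in> borel_measurable M" using \<zeta> by (rule measurable_seg_space_borel)
  define E where "E n j = {\<omega> \<in> space M. \<zeta> \<omega> \<notin> G n j}" for n j
  have E[measurable]: "E n j \<in> sets M" for n j unfolding E_def by measurable
  have "decseq (E n)" for n
    unfolding decseq_Suc_iff
  proof
    fix j
    have "1 / real (Suc (Suc j)) \<le> 1 / real (Suc j)" by (simp add: frac_le)
    then have "G n j \<subseteq> G n (Suc j)" unfolding G_def using order_trans by fastforce
    then show "E n (Suc j) \<subseteq> E n j" by (auto simp: E_def)
  qed
  moreover have "(\<Inter>j. E n j) = {}" for n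
  proof (rule ccontr)
    assume "(\<Inter>j. E n j) \<noteq> {}"
    then obtain \<omega> where \<omega>: "\<omega> \<in> space M" "\<And>j. \<zeta> \<omega> \<notin> G n j" by (auto simp: E_def)
    obtain d where d: "0 < d" "\<And>s t. dist s t < d \<Longrightarrow>
        dist (apply_bcontfun (\<zeta> \<omega>) s) (apply_bcontfun (\<zeta> \<omega>) t) < 1 / real (Suc n)"
      using seg_modulus[OF \<tau> measurable_seg_set[OF \<zeta> \<omega>(1)], of "1 / real (Suc n)"] by auto
    obtain j where j: "1 / real (Suc j) < d" using d(1) nat_approx_posE by blast
    obtain i where i: "norm (\<zeta> \<omega>) \<le> real i" using real_arch_simple by blast
    have "1 / real (Suc (max i j)) \<le> 1 / real (Suc j)" by (simp add: frac_le)
    with i j have "\<zeta> \<omega> \<in> G n (max i j)" unfolding G_def using d(2) by (fastforce intro: less_imp_le)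
    with \<omega>(2) show False by blast
  qed
  ultimately have "(\<lambda>j. measure M (E n j)) \<longlonglongrightarrow> 0" for n
    using finite_Lim_measure_decseq[of "E n"] E by (metis image_subsetI measure_empty)
  then have "\<forall>\<^sub>F j in sequentially. measure M (E n j) < (1/2) ^ (m + n)" for m n
    by (rule order_tendstoD) simp
  then have "\<exists>j. measure M (E n j) < (1/2) ^ (m + n)" for m n
    by (meson eventually_sequentially order_refl)
  then have "\<forall>m. \<exists>j. \<forall>n. measure M (E n (j n)) < (1/2) ^ (m + n)"
    by (intro allI choice)
  from choice[OF this] obtain j where j: "\<And>m n. measure M (E n (j m n)) < (1/2) ^ (m + n)"
    by blast
  \<comment> \<open>The norm bound is taken from \<open>n = 0\<close>, so that its failure is
    already contained in \<open>E 0 (j m 0)\<close>.\<close>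
  define K' :: "nat \<Rightarrow> (real \<Rightarrow>\<^sub>C 'b) set"
    where "K' m = equicont_segs \<tau> (\<lambda>n. 1 / real (Suc (j m n))) (real (j m 0))" for m
  have K': "compact (K' m)" "K' m \<subseteq> seg_set \<tau>" for m
    unfolding K'_def by (rule compact_equicont_segs[OF \<tau>]) (auto simp: equicont_segs_def)
  \<comment> \<open>The sets \<open>K' m\<close> need not be nested; finite unions make them
    increase and stay compact.\<close>
  define K where "K m = (\<Union>i\<le>m. K' i)" for m
  have [measurable]: "K' m \<in> sets borel" for m using K'(1)[THEN compact_imp_closed] by auto
  have meas: "measure M {\<omega> \<in> space M. \<zeta> \<omega> \<notin> K' m} \<le> 2 * (1/2) ^ m" for m
  proof -
    have "{\<omega> \<in> space M. \<zeta> \<omega> \<notin> K' m} \<subseteq> (\<Union>n. E n (j m n))"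
      using measurable_seg_set[OF \<zeta>] by (auto simp: K'_def E_def G_def equicont_segs_def)
    then have "measure M {\<omega> \<in> space M. \<zeta> \<omega> \<notin> K' m} \<le> measure M (\<Union>n. E n (j m n))"
      by (intro finite_measure_mono) auto
    also have s: "summable (\<lambda>n. (1/2::real) ^ (m + n))"
      by (simp add: power_add summable_mult)
    then have "measure M (\<Union>n. E n (j m n)) \<le> (\<Sum>n. measure M (E n (j m n)))"
      by (intro finite_measure_subadditive_countably summable_comparison_test'[OF s])
        (auto intro: less_imp_le j)
    also have "\<dots> \<le> (\<Sum>n. (1/2) ^ (m + n))"
      by (intro suminf_le s summable_comparison_test'[OF s] less_imp_le[OF j]) (auto intro: less_imp_le j)
    also have "\<dots> = 2 * (1/2) ^ m"
      by (simp add: power_add suminf_mult suminf_geometric)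
    finally show ?thesis .
  qed
  have "measure M {\<omega> \<in> space M. \<forall>m. \<zeta> \<omega> \<notin> K' m} \<le> 2 * (1/2) ^ m" for m
    by (rule order_trans[OF finite_measure_mono meas[of m]]) auto
  moreover have "(\<lambda>m. 2 * (1/2::real) ^ m) \<longlonglongrightarrow> 2 * 0"
    by (intro tendsto_intros LIMSEQ_power_zero) auto
  ultimately have "measure M {\<omega> \<in> space M. \<forall>m. \<zeta> \<omega> \<notin> K' m} \<le> 0"
    by (intro LIMSEQ_le_const[where X = "\<lambda>m. 2 * (1/2::real) ^ m"]) auto
  then have "emeasure M {\<omega> \<in> space M. \<forall>m. \<zeta> \<omega> \<notin> K' m} = 0"
    by (simp add: emeasure_eq_measure measure_le_0_iff)
  then have "AE \<omega> in M. \<not> (\<forall>m. \<zeta> \<omega> \<notin> K' m)" by (intro AE_I[OF subset_refl]) auto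
  then have "AE \<omega> in M. \<exists>m. \<zeta> \<omega> \<in> K m" by eventually_elim (auto simp: K_def)
  moreover have "incseq K" by (force simp: K_def incseq_def)
  moreover have "compact (K m) \<and> K m \<subseteq> seg_set \<tau>" for m
    using K' by (auto simp: K_def intro!: compact_UN)
  ultimately show ?thesis by blast
qed

section \<open>Restarting and gluing solutions\<close>

lemma usual_filtrationD:
  assumes "usual_filtration M F" "0 \<le> s" "s \<le> t"
  shows "subalgebra M (F s)" "space (F s) = space M" "sets (F s) \<subseteq> sets (F t)" "subalgebra (F t) (F s)"
proof -
  show "subalgebra M (F s)" and s: "space (F s) = space M" and m: "sets (F s) \<subseteq> sets (F t)"
    using assms by (auto simp: usual_filtration_def subalgebra_def)
  moreover have "space (F t) = space M"
    using assms by (auto simp: usual_filtration_def subalgebra_def)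
  ultimately show "subalgebra (F t) (F s)" by (simp add: subalgebra_def)
qed

lemma measurable_filtration_mono:
  "usual_filtration M F \<Longrightarrow> 0 \<le> s \<Longrightarrow> s \<le> t \<Longrightarrow> Y \<in> F s \<rightarrow>\<^sub>M N \<Longrightarrow> Y \<in> F t \<rightarrow>\<^sub>M N"
  using measurable_from_subalg usual_filtrationD(4) by blast

lemma measurable_filtration_ambient:
  "usual_filtration M F \<Longrightarrow> 0 \<le> s \<Longrightarrow> Y \<in> F s \<rightarrow>\<^sub>M N \<Longrightarrow> Y \<in> M \<rightarrow>\<^sub>M N"
  using measurable_from_subalg usual_filtrationD(1)[OF _ _ order_refl] by blast

text \<open>If a sum reaches \<open>e\<close>, one of its summands reaches \<open>e/2\<close>; the
  rest is a union bound. Measurability of \<open>Z\<close> is assumed separately since it is part of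
  \<open>null_in_prob\<close> and does not follow from domination.\<close>

lemma (in finite_measure) null_in_prob_le_add:
  assumes Z: "\<And>n. Z n \<in> borel_measurable M" and "null_in_prob M U" "null_in_prob M V"
    and le: "\<And>n \<omega>. \<omega> \<in> space M \<Longrightarrow> Z n \<omega> \<le> U n \<omega> + V n \<omega>"
  shows "null_in_prob M Z"
  unfolding null_in_prob_def
proof (intro conjI allI impI Z)
  fix e :: real assume e: "0 < e"
  have [measurable]: "U n \<in> borel_measurable M" "V n \<in> borel_measurable M" for n
    using assms(2,3) by (auto simp: null_in_prob_def)
  have lim: "(\<lambda>n. measure M {\<omega>\<in>space M. ennreal (e/2) \<le> U n \<omega>} + measure M {\<omega>\<in>space M. ennreal (e/2) \<le> V n \<omega>})
      \<longlonglongrightarrow> 0"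
    using assms(2,3) e by (intro tendsto_add_zero) (auto simp: null_in_prob_def)
  have le': "measure M {\<omega>\<in>space M. ennreal e \<le> Z n \<omega>}
      \<le> measure M {\<omega>\<in>space M. ennreal (e/2) \<le> U n \<omega>} + measure M {\<omega>\<in>space M. ennreal (e/2) \<le> V n \<omega>}" for n
  proof -
    have "ennreal (e/2) \<le> U n \<omega> \<or> ennreal (e/2) \<le> V n \<omega>" if "\<omega> \<in> space M" "ennreal e \<le> Z n \<omega>" for \<omega>
    proof (rule ccontr)
      assume "\<not> ?thesis"
      then have "U n \<omega> + V n \<omega> < ennreal (e/2) + ennreal (e/2)"
        by (intro add_strict_mono) auto
      also have "\<dots> = ennreal e" using e by (simp flip: ennreal_plus)
      finally show False using le[OF that(1), of n] that(2) by (metis leD order_trans)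
    qed
    then have "measure M {\<omega>\<in>space M. ennreal e \<le> Z n \<omega>}
        \<le> measure M ({\<omega>\<in>space M. ennreal (e/2) \<le> U n \<omega>} \<union> {\<omega>\<in>space M. ennreal (e/2) \<le> V n \<omega>})"
      by (intro finite_measure_mono) auto
    also have "\<dots> \<le> measure M {\<omega>\<in>space M. ennreal (e/2) \<le> U n \<omega>} + measure M {\<omega>\<in>space M. ennreal (e/2) \<le> V n \<omega>}"
      by (intro measure_Un_le) auto
    finally show ?thesis .
  qed
  show "(\<lambda>n. measure M {\<omega>\<in>space M. ennreal e \<le> Z n \<omega>}) \<longlonglongrightarrow> 0"
    by (rule tendsto_sandwich[OF _ _ tendsto_const lim]) (use le' in auto)
qed

lemma (in finite_measure) null_in_prob_If:
  assumes "A \<in> sets M" "null_in_prob M U" "null_in_prob M V"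
  shows "null_in_prob M (\<lambda>n \<omega>. if \<omega> \<in> A then U n \<omega> else V n \<omega>)"
proof (rule null_in_prob_le_add[OF _ assms(2,3)])
  show "(\<lambda>\<omega>. if \<omega> \<in> A then U n \<omega> else V n \<omega>) \<in> borel_measurable M" for n
    using assms by (intro measurable_If_set) (auto simp: null_in_prob_def)
qed (auto simp: le_add1 le_add2)

text \<open>Used with \<open>N\<close> equal to \<open>F t\<close> to restart an integrand at a
  later time, and with \<open>N\<close> equal to \<open>M\<close> to measure approximation
  errors.\<close>

lemma progressive_measurable_pair:
  assumes "progressive F s G" "usual_filtration M F" "0 \<le> s" "s \<le> r" "r \<le> t"
    and "subalgebra N (F t)"
  shows "(\<lambda>(u, \<omega>). G u \<omega>) \<in> borel_measurable (restrict_space borel {r..t} \<Otimes>\<^sub>M N)"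
proof -
  have "(\<lambda>x. (fst x, snd x)) \<in> restrict_space borel {r..t} \<Otimes>\<^sub>M N \<rightarrow>\<^sub>M restrict_space borel {s..t} \<Otimes>\<^sub>M F t"
  proof (rule measurable_Pair)
    have "id \<in> restrict_space borel {r..t} \<rightarrow>\<^sub>M (restrict_space borel {s..t} :: real measure)"
      using assms(4) by (intro measurable_restrict_space2 measurable_restrict_space1)
        (auto simp: space_restrict_space id_def)
    from measurable_compose[OF measurable_fst this]
    show "fst \<in> restrict_space borel {r..t} \<Otimes>\<^sub>M N \<rightarrow>\<^sub>M restrict_space borel {s..t}" by (simp add: id_def)
    have "id \<in> N \<rightarrow>\<^sub>M F t" by (rule measurable_from_subalg[OF assms(6) measurable_ident])
    from measurable_compose[OF measurable_snd this]
    show "snd \<in> restrict_space borel {r..t} \<Otimes>\<^sub>M N \<rightarrow>\<^sub>M F t" by (simp add: id_def)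
  qed
  moreover have "(\<lambda>(u, \<omega>). G u \<omega>) \<in> borel_measurable (restrict_space borel {s..t} \<Otimes>\<^sub>M F t)"
    using assms(1,4,5) by (simp add: progressive_def)
  ultimately have "(\<lambda>x. (\<lambda>(u, \<omega>). G u \<omega>) (fst x, snd x)) \<in> borel_measurable (restrict_space borel {r..t} \<Otimes>\<^sub>M N)"
    by (rule measurable_compose)
  then show ?thesis by (simp add: case_prod_unfold)
qed

section \<open>Restarting the Ito integral\<close>

text \<open>The restriction of the simple process to times after \<open>s\<close>. Intervals that
  end before \<open>s\<close> stay in the list, collapsed to the empty interval from
  \<open>s\<close> to \<open>s\<close>.\<close>

definition restart_proc :: "real \<Rightarrow> ('a, 'm::finite, 'd::finite) simple_proc \<Rightarrow> ('a, 'm, 'd) simple_proc" where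
  "restart_proc s S = map (\<lambda>(a, b, \<Phi>). (max a s, max b s, \<Phi>)) S"

lemma simple_proc_restart:
  assumes "usual_filtration M F" "0 \<le> r" "r \<le> s" "simple_proc F r S"
  shows "simple_proc F s (restart_proc s S)"
proof -
  have "max a s \<le> max b s \<and> \<Phi> \<in> borel_measurable (F (max a s)) \<and> bounded (\<Phi> ` space (F (max a s)))"
    if "(a, b, \<Phi>) \<in> set S" for a b \<Phi>
  proof -
    have *: "r \<le> a" "a \<le> b" "\<Phi> \<in> borel_measurable (F a)" "bounded (\<Phi> ` space (F a))"
      using assms(4) that by (auto simp: simple_proc_def)
    have "space (F a) = space M" "space (F (max a s)) = space M"
      using usual_filtrationD(2)[OF assms(1) _ order_refl] *(1) assms(2,3) by auto
    then show ?thesis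
      using * measurable_filtration_mono[OF assms(1), of a "max a s"] assms(2,3) by auto
  qed
  then show ?thesis by (force simp: simple_proc_def restart_proc_def)
qed

lemma simple_val_restart: "s < u \<Longrightarrow> simple_val (restart_proc s S) u \<omega> = simple_val S u \<omega>"
  unfolding simple_val_def restart_proc_def
  by (auto intro!: arg_cong[where f=sum_list] simp: indicator_def le_max_iff_disj)

text \<open>Stopping at \<open>max h s\<close> instead of \<open>h\<close> changes
  \<open>W (min h t)\<close> by \<open>W s - W (min h s)\<close>; the term \<open>W s\<close>
  cancels in every increment.\<close>

lemma simple_int_restart:
  "s \<le> t \<Longrightarrow> simple_int W (restart_proc s S) t \<omega> = simple_int W S t \<omega> - simple_int W S s \<omega>"
proof (induction S)
  case (Cons c S)
  obtain a b \<Phi> where c: "c = (a, b, \<Phi>)" by (cases c)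
  have W: "W (min (max h s) t) \<omega> = W (min h t) \<omega> - W (min h s) \<omega> + W s \<omega>" for h
    using \<open>s \<le> t\<close> by (cases "h \<le> s") (auto simp: max_def min_def)
  have "\<Phi> \<omega> *v (W (min (max b s) t) \<omega> - W (min (max a s) t) \<omega>)
      = \<Phi> \<omega> *v (W (min b t) \<omega> - W (min a t) \<omega>) - \<Phi> \<omega> *v (W (min b s) \<omega> - W (min a s) \<omega>)"
    unfolding W matrix_vector_mult_diff_distrib[symmetric] by (simp add: algebra_simps)
  with Cons c show ?case by (simp add: simple_int_def restart_proc_def)
qed (simp add: simple_int_def restart_proc_def)

lemma borel_measurable_matrix_vector_mult:
  fixes A :: "'a \<Rightarrow> real^'m^'d"
  assumes "A \<in> borel_measurable N" "v \<in> borel_measurable N"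
  shows "(\<lambda>\<omega>. A \<omega> *v v \<omega>) \<in> borel_measurable N"
  using assms
  by (rule borel_measurable_continuous_Pair[where H="\<lambda>A v. A *v v"])
    (auto simp: matrix_vector_mult_def intro!: continuous_on_vec_lambda continuous_intros)

lemma simple_int_measurable:
  assumes "usual_filtration M F" "brownian_motion M F W" "0 \<le> s" "s \<le> t" "simple_proc F s S"
  shows "simple_int W S t \<in> borel_measurable M"
  using assms(5)
proof (induction S)
  case (Cons c S)
  obtain a b \<Phi> where c: "c = (a, b, \<Phi>)" by (cases c)
  have *: "s \<le> a" "a \<le> b" "\<Phi> \<in> borel_measurable (F a)" "simple_proc F s S"
    using Cons.prems by (auto simp: simple_proc_def c)
  have [measurable]: "\<Phi> \<in> borel_measurable M"
    using measurable_filtration_ambient[OF assms(1) _ *(3)] *(1) assms(3) by simp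
  have [measurable]: "W h \<in> borel_measurable M" if "0 \<le> h" for h
    using measurable_filtration_ambient[OF assms(1) that] assms(2) that
    by (auto simp: brownian_motion_def)
  have "(\<lambda>\<omega>. \<Phi> \<omega> *v (W (min b t) \<omega> - W (min a t) \<omega>)) \<in> borel_measurable M"
    using *(1,2) assms(3,4) by (intro borel_measurable_matrix_vector_mult borel_measurable_diff) auto
  moreover have "simple_int W (c # S) t
      = (\<lambda>\<omega>. \<Phi> \<omega> *v (W (min b t) \<omega> - W (min a t) \<omega>) + simple_int W S t \<omega>)"
    by (auto simp: simple_int_def c)
  ultimately show ?case using Cons.IH[OF *(4)] by simp
qed (simp add: simple_int_def[abs_def])

lemma simple_val_measurable_pair:
  assumes "usual_filtration M F" "0 \<le> s" "simple_proc F s S"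
  shows "(\<lambda>(u, \<omega>). simple_val S u \<omega>) \<in> borel_measurable (borel \<Otimes>\<^sub>M M)"
  using assms(3)
proof (induction S)
  case (Cons c S)
  obtain a b \<Phi> where c: "c = (a, b, \<Phi>)" by (cases c)
  have *: "s \<le> a" "\<Phi> \<in> borel_measurable (F a)" "simple_proc F s S"
    using Cons.prems by (auto simp: simple_proc_def c)
  have [measurable]: "\<Phi> \<in> borel_measurable M"
    using measurable_filtration_ambient[OF assms(1) _ *(2)] *(1) assms(2) by simp
  have [measurable]: "(\<lambda>(u, \<omega>). simple_val S u \<omega>) \<in> borel_measurable (borel \<Otimes>\<^sub>M M)" using Cons.IH *(3) .
  have "(\<lambda>(u, \<omega>). simple_val (c # S) u \<omega>)
      = (\<lambda>(u, \<omega>). indicator {a<..b} u *\<^sub>R \<Phi> \<omega> + (\<lambda>(u, \<omega>). simple_val S u \<omega>) (u, \<omega>))"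
    by (auto simp: simple_val_def c)
  also have "\<dots> \<in> borel_measurable (borel \<Otimes>\<^sub>M M)" by measurable
  finally show ?case .
next
  case Nil
  show ?case by (simp add: simple_val_def case_prod_unfold)
qed

text \<open>The measurability demanded by \<open>null_in_prob\<close>: progressiveness gives joint
  measurability, and integrating out the time over a finite measure preserves measurability in
  \<open>\<omega>\<close>.\<close>

lemma simple_approx_error_measurable:
  assumes "usual_filtration M F" "0 \<le> s" "s \<le> t" "simple_proc F s S" "progressive F s G"
  shows "(\<lambda>\<omega>. \<integral>\<^sup>+u\<in>{s..t}. ennreal ((norm (simple_val S u \<omega> - G u \<omega>))\<^sup>2) \<partial>lborel) \<in> borel_measurable M"
proof -
  let ?R = "restrict_space lborel {s..t}"
  interpret R: finite_measure ?R by (intro finite_measureI) (simp add: emeasure_restrict_space space_restrict_space emeasure_lborel_Icc_eq)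
  have sets: "sets (?R \<Otimes>\<^sub>M M) = sets (restrict_space borel {s..t} \<Otimes>\<^sub>M M)"
    by (intro sets_pair_measure_cong sets_restrict_space_cong) auto
  have "subalgebra M (F t)" using usual_filtrationD(1)[OF assms(1) _ order_refl] assms(2,3) by simp
  then have [measurable]: "(\<lambda>(u, \<omega>). G u \<omega>) \<in> borel_measurable (?R \<Otimes>\<^sub>M M)"
    using progressive_measurable_pair[OF assms(5,1,2) order_refl assms(3)]
    by (simp add: measurable_cong_sets[OF sets refl])
  have "(\<lambda>x. (fst x, snd x)) \<in> restrict_space borel {s..t} \<Otimes>\<^sub>M M \<rightarrow>\<^sub>M borel \<Otimes>\<^sub>M M"
    by (intro measurable_Pair measurable_compose[OF measurable_fst] measurable_snd measurable_restrict_space1) auto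
  from measurable_compose[OF this simple_val_measurable_pair[OF assms(1,2,4)]]
  have [measurable]: "(\<lambda>(u, \<omega>). simple_val S u \<omega>) \<in> borel_measurable (?R \<Otimes>\<^sub>M M)"
    by (simp add: measurable_cong_sets[OF sets refl])
  have "(\<lambda>(\<omega>, u). ennreal ((norm ((\<lambda>(u, \<omega>). simple_val S u \<omega>) (u, \<omega>) - (\<lambda>(u, \<omega>). G u \<omega>) (u, \<omega>)))\<^sup>2)) \<in> borel_measurable (M \<Otimes>\<^sub>M ?R)"
    by measurable
  from R.borel_measurable_nn_integral[OF this]
  show ?thesis by (simp add: nn_integral_restrict_space)
qed

text \<open>The approximating simple processes, cut at \<open>s\<close>, still approximate: the
  error of the integrands over \<open>{s..t}\<close> is at most the one over \<open>{r..t}\<close>,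
  and the error of the integrals is at most the sum of the errors at \<open>t\<close> and at
  \<open>s\<close>.\<close>

lemma (in prob_space) ito_integral_restart:
  assumes "usual_filtration M F" "brownian_motion M F W" "0 \<le> r" "r \<le> s" and I: "ito_integral M F W r G I"
  shows "ito_integral M F W s G (\<lambda>t \<omega>. I t \<omega> - I s \<omega>)"
proof -
  from I obtain S where G: "progressive F r G"
    and fin: "AE \<omega> in M. \<forall>t\<ge>r. (\<integral>\<^sup>+u\<in>{r..t}. ennreal ((norm (G u \<omega>))\<^sup>2) \<partial>lborel) < \<infinity>"
    and Im: "\<And>t. r \<le> t \<Longrightarrow> I t \<in> borel_measurable (F t)"
    and Ic: "\<And>\<omega>. \<omega> \<in> space M \<Longrightarrow> continuous_on {r..} (\<lambda>t. I t \<omega>)"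
    and S: "\<And>n. simple_proc F r (S n)"
    and Sv: "\<And>t. r \<le> t \<Longrightarrow> null_in_prob M (\<lambda>n \<omega>. \<integral>\<^sup>+u\<in>{r..t}. ennreal ((norm (simple_val (S n) u \<omega> - G u \<omega>))\<^sup>2) \<partial>lborel)"
    and Si: "\<And>t. r \<le> t \<Longrightarrow> null_in_prob M (\<lambda>n \<omega>. ennreal (norm (simple_int W (S n) t \<omega> - I t \<omega>)))"
    unfolding ito_integral_def by blast
  have s: "0 \<le> s" using assms by simp
  have G': "progressive F s G"
    unfolding progressive_def
    using progressive_measurable_pair[OF G assms(1,3,4)] by (auto simp: subalgebra_def)
  have S': "simple_proc F s (restart_proc s (S n))" for n
    using simple_proc_restart[OF assms(1,3,4) S] .
  have mono: "(\<integral>\<^sup>+u\<in>{s..t}. h u \<partial>lborel) \<le> (\<integral>\<^sup>+u\<in>{r..t}. h u \<partial>lborel)" for t and h :: "real \<Rightarrow> ennreal"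
    using assms(4) by (intro nn_integral_mono) (auto simp: indicator_def)
  have null1: "null_in_prob M (\<lambda>n \<omega>. \<integral>\<^sup>+u\<in>{s..t}. ennreal ((norm (simple_val (restart_proc s (S n)) u \<omega> - G u \<omega>))\<^sup>2) \<partial>lborel)"
    if "s \<le> t" for t
  proof (rule null_in_prob_le_add)
    show "null_in_prob M (\<lambda>n \<omega>. \<integral>\<^sup>+u\<in>{r..t}. ennreal ((norm (simple_val (S n) u \<omega> - G u \<omega>))\<^sup>2) \<partial>lborel)"
      using Sv assms(4) that by simp
    then show "null_in_prob M (\<lambda>n \<omega>. \<integral>\<^sup>+u\<in>{r..t}. ennreal ((norm (simple_val (S n) u \<omega> - G u \<omega>))\<^sup>2) \<partial>lborel)" .
    show "(\<lambda>\<omega>. \<integral>\<^sup>+u\<in>{s..t}. ennreal ((norm (simple_val (restart_proc s (S n)) u \<omega> - G u \<omega>))\<^sup>2) \<partial>lborel) \<in> borel_measurable M" for n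
      by (rule simple_approx_error_measurable[OF assms(1) s that S' G'])
    fix n \<omega>
    \<comment> \<open>Cutting a half-open interval at \<open>s\<close> can change the value of the
      process at \<open>u = s\<close> itself, which is a null set of times.\<close>
    have "AE u in lborel. u \<noteq> s" by (rule AE_lborel_singleton)
    then have "(\<integral>\<^sup>+u\<in>{s..t}. ennreal ((norm (simple_val (restart_proc s (S n)) u \<omega> - G u \<omega>))\<^sup>2) \<partial>lborel)
        = (\<integral>\<^sup>+u\<in>{s..t}. ennreal ((norm (simple_val (S n) u \<omega> - G u \<omega>))\<^sup>2) \<partial>lborel)"
      by (intro nn_integral_cong_AE, eventually_elim) (auto simp: indicator_def simple_val_restart)
    also have "\<dots> \<le> (\<integral>\<^sup>+u\<in>{r..t}. ennreal ((norm (simple_val (S n) u \<omega> - G u \<omega>))\<^sup>2) \<partial>lborel)"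
      by (rule mono)
    finally show "(\<integral>\<^sup>+u\<in>{s..t}. ennreal ((norm (simple_val (restart_proc s (S n)) u \<omega> - G u \<omega>))\<^sup>2) \<partial>lborel)
      \<le> (\<integral>\<^sup>+u\<in>{r..t}. ennreal ((norm (simple_val (S n) u \<omega> - G u \<omega>))\<^sup>2) \<partial>lborel)
        + (\<integral>\<^sup>+u\<in>{r..t}. ennreal ((norm (simple_val (S n) u \<omega> - G u \<omega>))\<^sup>2) \<partial>lborel)"
      by (rule add_increasing2[OF zero_le])
  qed
  have null2: "null_in_prob M (\<lambda>n \<omega>. ennreal (norm (simple_int W (restart_proc s (S n)) t \<omega> - (I t \<omega> - I s \<omega>))))"
    if "s \<le> t" for t
  proof (rule null_in_prob_le_add[OF _ Si Si])
    have [measurable]: "I t \<in> borel_measurable M" "I s \<in> borel_measurable M"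
      "simple_int W (restart_proc s (S n)) t \<in> borel_measurable M" for n
      using measurable_filtration_ambient[OF assms(1) _ Im] simple_int_measurable[OF assms(1,2) s that S']
        s assms(4) that by auto
    show "(\<lambda>\<omega>. ennreal (norm (simple_int W (restart_proc s (S n)) t \<omega> - (I t \<omega> - I s \<omega>)))) \<in> borel_measurable M" for n
      by measurable
    show "r \<le> t" "r \<le> s" using assms(4) that by auto
    fix n \<omega>
    have *: "simple_int W (restart_proc s (S n)) t \<omega> - (I t \<omega> - I s \<omega>)
        = (simple_int W (S n) t \<omega> - I t \<omega>) - (simple_int W (S n) s \<omega> - I s \<omega>)"
      by (simp add: simple_int_restart[OF that])
    show "ennreal (norm (simple_int W (restart_proc s (S n)) t \<omega> - (I t \<omega> - I s \<omega>)))
        \<le> ennreal (norm (simple_int W (S n) t \<omega> - I t \<omega>)) + ennreal (norm (simple_int W (S n) s \<omega> - I s \<omega>))"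
      unfolding * by (simp add: norm_triangle_ineq4 flip: ennreal_plus)
  qed
  have "AE \<omega> in M. \<forall>t\<ge>s. (\<integral>\<^sup>+u\<in>{s..t}. ennreal ((norm (G u \<omega>))\<^sup>2) \<partial>lborel) < \<infinity>"
    using fin by eventually_elim (use mono assms(4) in \<open>meson le_less_trans order_trans\<close>)
  moreover have "(\<lambda>\<omega>. I t \<omega> - I s \<omega>) \<in> borel_measurable (F t)" if "s \<le> t" for t
    using that assms(4) s Im measurable_filtration_mono[OF assms(1) s that Im] by (intro borel_measurable_diff) auto
  moreover have "continuous_on {s..} (\<lambda>t. I t \<omega> - I s \<omega>)" if "\<omega> \<in> space M" for \<omega>
    using assms(4) by (intro continuous_intros continuous_on_subset[OF Ic[OF that]]) auto
  ultimately show ?thesis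
    unfolding ito_integral_def using G' S' null1 null2
    by (intro conjI allI impI ballI exI[of _ "\<lambda>n. restart_proc s (S n)"]) auto
qed

section \<open>Gluing along an event known at the starting time\<close>

text \<open>Appending lists adds simple processes. The coefficients are cut off to \<open>A\<close>
  and to its complement, so that for each \<open>\<omega>\<close> only one of the two summands
  survives.\<close>

definition glue_proc ::
  "'a set \<Rightarrow> ('a, 'm::finite, 'd::finite) simple_proc \<Rightarrow> ('a, 'm, 'd) simple_proc \<Rightarrow> ('a, 'm, 'd) simple_proc" where
  "glue_proc A S R = map (\<lambda>(a, b, \<Phi>). (a, b, \<lambda>\<omega>. if \<omega> \<in> A then \<Phi> \<omega> else 0)) S
     @ map (\<lambda>(a, b, \<Phi>). (a, b, \<lambda>\<omega>. if \<omega> \<in> A then 0 else \<Phi> \<omega>)) R"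

lemma glue_proc_simps:
  "simple_val (glue_proc A S R) u \<omega> = (if \<omega> \<in> A then simple_val S u \<omega> else simple_val R u \<omega>)"
  "simple_int W (glue_proc A S R) t \<omega> = (if \<omega> \<in> A then simple_int W S t \<omega> else simple_int W R t \<omega>)"
proof -
  have z: "sum_list (map (\<lambda>x. 0) L) = (0 :: 'z::comm_monoid_add)" for L :: "'y list" by (induction L) auto
  show "simple_val (glue_proc A S R) u \<omega> = (if \<omega> \<in> A then simple_val S u \<omega> else simple_val R u \<omega>)"
    by (auto simp: simple_val_def glue_proc_def comp_def case_prod_unfold z)
  show "simple_int W (glue_proc A S R) t \<omega> = (if \<omega> \<in> A then simple_int W S t \<omega> else simple_int W R t \<omega>)"
    by (auto simp: simple_int_def glue_proc_def comp_def case_prod_unfold z)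
qed

text \<open>Coefficients stay adapted because \<open>A\<close>, known at time \<open>s\<close>, is
  known at the left end of every interval.\<close>

lemma simple_proc_glue:
  assumes "usual_filtration M F" "0 \<le> s" "A \<in> sets (F s)" "simple_proc F s S" "simple_proc F s R"
  shows "simple_proc F s (glue_proc A S R)"
proof -
  have "(\<lambda>\<omega>. if \<omega> \<in> A then \<Phi> \<omega> else 0) \<in> borel_measurable (F a)
      \<and> bounded ((\<lambda>\<omega>. if \<omega> \<in> A then \<Phi> \<omega> else 0) ` space (F a))
      \<and> (\<lambda>\<omega>. if \<omega> \<in> A then 0 else \<Phi> \<omega>) \<in> borel_measurable (F a)
      \<and> bounded ((\<lambda>\<omega>. if \<omega> \<in> A then 0 else \<Phi> \<omega>) ` space (F a))"
    if "s \<le> a" "\<Phi> \<in> borel_measurable (F a)" "bounded (\<Phi> ` space (F a))" for a and \<Phi> :: "'a \<Rightarrow> real^'b^'c"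
  proof -
    have A: "A \<inter> space (F a) \<in> sets (F a)" using usual_filtrationD(3)[OF assms(1,2) that(1)] assms(3) by auto
    have "bounded (insert 0 (\<Phi> ` space (F a)))" using that(3) by simp
    then have "bounded ((\<lambda>\<omega>. if \<omega> \<in> A then \<Phi> \<omega> else 0) ` space (F a))"
      "bounded ((\<lambda>\<omega>. if \<omega> \<in> A then 0 else \<Phi> \<omega>) ` space (F a))"
      by (rule bounded_subset; auto)+
    then show ?thesis using that(2) A by (auto intro!: measurable_If_set)
  qed
  with assms(4,5) show ?thesis by (auto simp: simple_proc_def glue_proc_def)
qed

text \<open>For each \<open>\<omega>\<close> the error of the glued approximation is one of the two
  given errors, so \<open>null_in_prob_If\<close> applies to integrands and integrals alike.\<close>

lemma (in prob_space) ito_integral_glue: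
  assumes "usual_filtration M F" "0 \<le> s" "A \<in> sets (F s)"
    and "ito_integral M F W s G I" "ito_integral M F W s H J"
  shows "ito_integral M F W s (\<lambda>u \<omega>. if \<omega> \<in> A then G u \<omega> else H u \<omega>) (\<lambda>t \<omega>. if \<omega> \<in> A then I t \<omega> else J t \<omega>)"
proof -
  obtain S where S: "\<And>n. simple_proc F s (S n)"
    and Sv: "\<And>t. s \<le> t \<Longrightarrow> null_in_prob M (\<lambda>n \<omega>. \<integral>\<^sup>+u\<in>{s..t}. ennreal ((norm (simple_val (S n) u \<omega> - G u \<omega>))\<^sup>2) \<partial>lborel)"
    and Si: "\<And>t. s \<le> t \<Longrightarrow> null_in_prob M (\<lambda>n \<omega>. ennreal (norm (simple_int W (S n) t \<omega> - I t \<omega>)))"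
    using assms(4) unfolding ito_integral_def by blast
  obtain R where R: "\<And>n. simple_proc F s (R n)"
    and Rv: "\<And>t. s \<le> t \<Longrightarrow> null_in_prob M (\<lambda>n \<omega>. \<integral>\<^sup>+u\<in>{s..t}. ennreal ((norm (simple_val (R n) u \<omega> - H u \<omega>))\<^sup>2) \<partial>lborel)"
    and Ri: "\<And>t. s \<le> t \<Longrightarrow> null_in_prob M (\<lambda>n \<omega>. ennreal (norm (simple_int W (R n) t \<omega> - J t \<omega>)))"
    using assms(5) unfolding ito_integral_def by blast
  have AF: "A \<in> sets (F t)" if "s \<le> t" for t using usual_filtrationD(3)[OF assms(1,2) that] assms(3) by auto
  have AM: "A \<in> sets M" using usual_filtrationD(1)[OF assms(1,2) order_refl] assms(3) by (auto simp: subalgebra_def)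
  have "progressive F s (\<lambda>u \<omega>. if \<omega> \<in> A then G u \<omega> else H u \<omega>)"
    unfolding progressive_def
  proof (intro allI impI)
    fix t assume t: "s \<le> t"
    have [measurable]: "A \<in> sets (F t)" using AF t .
    let ?N = "restrict_space borel {s..t} \<Otimes>\<^sub>M F t"
    have [measurable]: "(\<lambda>(u, \<omega>). G u \<omega>) \<in> borel_measurable ?N" "(\<lambda>(u, \<omega>). H u \<omega>) \<in> borel_measurable ?N"
      using assms(4,5) t by (auto simp: ito_integral_def progressive_def)
    have "(\<lambda>x. if snd x \<in> A then (\<lambda>(u, \<omega>). G u \<omega>) x else (\<lambda>(u, \<omega>). H u \<omega>) x) \<in> borel_measurable ?N"
      by measurable
    then show "(\<lambda>(u, \<omega>). if \<omega> \<in> A then G u \<omega> else H u \<omega>) \<in> borel_measurable ?N"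
      by (simp add: case_prod_unfold)
  qed
  moreover have "AE \<omega> in M. \<forall>t\<ge>s. (\<integral>\<^sup>+u\<in>{s..t}. ennreal ((norm (G u \<omega>))\<^sup>2) \<partial>lborel) < \<infinity>"
      "AE \<omega> in M. \<forall>t\<ge>s. (\<integral>\<^sup>+u\<in>{s..t}. ennreal ((norm (H u \<omega>))\<^sup>2) \<partial>lborel) < \<infinity>"
    using assms(4,5) by (auto simp: ito_integral_def)
  then have "AE \<omega> in M. \<forall>t\<ge>s. (\<integral>\<^sup>+u\<in>{s..t}. ennreal ((norm (if \<omega> \<in> A then G u \<omega> else H u \<omega>))\<^sup>2) \<partial>lborel) < \<infinity>"
  proof eventually_elim
    case (elim \<omega>) then show ?case by (cases "\<omega> \<in> A") simp_all
  qed
  moreover have "(\<lambda>\<omega>. if \<omega> \<in> A then I t \<omega> else J t \<omega>) \<in> borel_measurable (F t)" if "s \<le> t" for t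
    using assms(4,5) that AF[OF that] by (intro measurable_If_set) (auto simp: ito_integral_def)
  moreover have "continuous_on {s..} (\<lambda>t. if \<omega> \<in> A then I t \<omega> else J t \<omega>)" if "\<omega> \<in> space M" for \<omega>
    using assms(4,5) that by (cases "\<omega> \<in> A") (auto simp: ito_integral_def)
  moreover have "null_in_prob M (\<lambda>n \<omega>. \<integral>\<^sup>+u\<in>{s..t}. ennreal ((norm (simple_val (glue_proc A (S n) (R n)) u \<omega>
      - (if \<omega> \<in> A then G u \<omega> else H u \<omega>)))\<^sup>2) \<partial>lborel)" if "s \<le> t" for t
    using null_in_prob_If[OF AM Sv[OF that] Rv[OF that]] by (rule back_subst[of "null_in_prob M"]) (auto simp: glue_proc_simps fun_eq_iff)
  moreover have "null_in_prob M (\<lambda>n \<omega>. ennreal (norm (simple_int W (glue_proc A (S n) (R n)) t \<omega>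
      - (if \<omega> \<in> A then I t \<omega> else J t \<omega>))))" if "s \<le> t" for t
    using null_in_prob_If[OF AM Si[OF that] Ri[OF that]] by (rule back_subst[of "null_in_prob M"]) (auto simp: glue_proc_simps fun_eq_iff)
  ultimately show ?thesis
    unfolding ito_integral_def using simple_proc_glue[OF assms(1-3) S R]
    by (intro conjI allI impI ballI exI[of _ "\<lambda>n. glue_proc A (S n) (R n)"]) auto
qed

section \<open>Locality and flow property of the exact solution\<close>

lemma sdde_solutionD:
  assumes "sdde_solution M F W \<tau> f g s \<eta> y"
  shows "\<And>\<omega> \<theta>. \<omega> \<in> space M \<Longrightarrow> \<theta> \<in> {-\<tau>..0} \<Longrightarrow> y (s + \<theta>) \<omega> = apply_bcontfun (\<eta> \<omega>) \<theta>"
    and "\<And>\<omega>. \<omega> \<in> space M \<Longrightarrow> continuous_on {s - \<tau>..} (\<lambda>t. y t \<omega>)"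
    and "\<And>t. s \<le> t \<Longrightarrow> y t \<in> borel_measurable (F t)"
    and "AE \<omega> in M. \<forall>t\<ge>s. set_integrable lborel {s..t} (\<lambda>u. f (y u \<omega>) (y (u - \<tau>) \<omega>))"
    and "\<exists>I. ito_integral M F W s (\<lambda>u \<omega>. g (y u \<omega>) (y (u - \<tau>) \<omega>)) I \<and>
       (AE \<omega> in M. \<forall>t\<ge>s.
          y t \<omega> = apply_bcontfun (\<eta> \<omega>) 0 + (LINT u:{s..t}|lborel. f (y u \<omega>) (y (u - \<tau>) \<omega>)) + I t \<omega>)"
  using assms unfolding sdde_solution_def by blast+

text \<open>Apart from measurability and the stochastic integral, the conditions are checked path by
  path; \<open>ito_integral_glue\<close> supplies the integral.\<close>

lemma (in prob_space) sdde_solution_glue: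
  assumes F: "usual_filtration M F" "0 \<le> s" "A \<in> sets (F s)"
    and y: "sdde_solution M F W \<tau> f g s \<zeta> y" and z: "sdde_solution M F W \<tau> f g s \<eta> z"
  shows "sdde_solution M F W \<tau> f g s (\<lambda>\<omega>. if \<omega> \<in> A then \<zeta> \<omega> else \<eta> \<omega>)
    (\<lambda>t \<omega>. if \<omega> \<in> A then y t \<omega> else z t \<omega>)"
proof -
  obtain I where I: "ito_integral M F W s (\<lambda>u \<omega>. g (y u \<omega>) (y (u - \<tau>) \<omega>)) I"
    and Ie: "AE \<omega> in M. \<forall>t\<ge>s. y t \<omega> = apply_bcontfun (\<zeta> \<omega>) 0
      + (LINT u:{s..t}|lborel. f (y u \<omega>) (y (u - \<tau>) \<omega>)) + I t \<omega>"
    using sdde_solutionD(5)[OF y] by blast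
  obtain J where J: "ito_integral M F W s (\<lambda>u \<omega>. g (z u \<omega>) (z (u - \<tau>) \<omega>)) J"
    and Je: "AE \<omega> in M. \<forall>t\<ge>s. z t \<omega> = apply_bcontfun (\<eta> \<omega>) 0
      + (LINT u:{s..t}|lborel. f (z u \<omega>) (z (u - \<tau>) \<omega>)) + J t \<omega>"
    using sdde_solutionD(5)[OF z] by blast
  define v where "v = (\<lambda>t \<omega>. if \<omega> \<in> A then y t \<omega> else z t \<omega>)"
  have v: "\<omega> \<in> A \<Longrightarrow> v t \<omega> = y t \<omega>" "\<omega> \<notin> A \<Longrightarrow> v t \<omega> = z t \<omega>" for t \<omega>
    by (auto simp: v_def)
  have AF: "A \<inter> space (F t) \<in> sets (F t)" if "s \<le> t" for t
    using usual_filtrationD(3)[OF F(1,2) that] F(3) by auto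
  have "v t \<in> borel_measurable (F t)" if "s \<le> t" for t
    unfolding v_def using sdde_solutionD(3)[OF y that] sdde_solutionD(3)[OF z that] AF[OF that]
    by (intro measurable_If_set)
  moreover have "AE \<omega> in M. \<forall>t\<ge>s. set_integrable lborel {s..t} (\<lambda>u. f (v u \<omega>) (v (u - \<tau>) \<omega>))"
    using sdde_solutionD(4)[OF y] sdde_solutionD(4)[OF z]
  proof eventually_elim
    case (elim \<omega>) then show ?case by (cases "\<omega> \<in> A") (simp_all add: v)
  qed
  moreover have "(\<lambda>u \<omega>. if \<omega> \<in> A then g (y u \<omega>) (y (u - \<tau>) \<omega>) else g (z u \<omega>) (z (u - \<tau>) \<omega>))
      = (\<lambda>u \<omega>. g (v u \<omega>) (v (u - \<tau>) \<omega>))"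
    by (auto simp: v_def fun_eq_iff)
  with ito_integral_glue[OF F I J]
  have "ito_integral M F W s (\<lambda>u \<omega>. g (v u \<omega>) (v (u - \<tau>) \<omega>)) (\<lambda>t \<omega>. if \<omega> \<in> A then I t \<omega> else J t \<omega>)"
    by simp
  moreover have "AE \<omega> in M. \<forall>t\<ge>s. v t \<omega> = apply_bcontfun (if \<omega> \<in> A then \<zeta> \<omega> else \<eta> \<omega>) 0
      + (LINT u:{s..t}|lborel. f (v u \<omega>) (v (u - \<tau>) \<omega>)) + (if \<omega> \<in> A then I t \<omega> else J t \<omega>)"
    using Ie Je
  proof eventually_elim
    case (elim \<omega>) then show ?case by (cases "\<omega> \<in> A") (simp_all add: v)
  qed
  moreover have "v (s + \<theta>) \<omega> = apply_bcontfun (if \<omega> \<in> A then \<zeta> \<omega> else \<eta> \<omega>) \<theta>"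
    if "\<omega> \<in> space M" "\<theta> \<in> {-\<tau>..0}" for \<omega> \<theta>
    using sdde_solutionD(1)[OF y that] sdde_solutionD(1)[OF z that] by (simp add: v_def)
  moreover have "continuous_on {s - \<tau>..} (\<lambda>t. v t \<omega>)" if "\<omega> \<in> space M" for \<omega>
    using sdde_solutionD(2)[OF y that] sdde_solutionD(2)[OF z that] by (cases "\<omega> \<in> A") (simp_all add: v)
  ultimately show ?thesis unfolding sdde_solution_def v_def[symmetric] by blast
qed

text \<open>Gluing \<open>\<zeta>\<close> on \<open>A\<close> to \<open>\<eta>\<close> off
  \<open>A\<close> gives back \<open>\<eta>\<close>. The glued process is thus another solution from
  \<open>\<eta>\<close>, and uniqueness identifies it with \<open>x s \<eta>\<close>.\<close>

lemma (in prob_space) sdde_solution_local: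
  assumes F: "usual_filtration M F" "0 \<le> s" "A \<in> sets (F s)"
    and x: "unique_sdde_solution M F W \<tau> f g x"
    and \<zeta>: "\<zeta> \<in> F s \<rightarrow>\<^sub>M seg_space \<tau>" and \<eta>: "\<eta> \<in> F s \<rightarrow>\<^sub>M seg_space \<tau>"
    and eq: "\<And>\<omega>. \<omega> \<in> A \<Longrightarrow> \<zeta> \<omega> = \<eta> \<omega>"
  shows "AE \<omega> in M. \<omega> \<in> A \<longrightarrow> (\<forall>t\<ge>s - \<tau>. x s \<zeta> t \<omega> = x s \<eta> t \<omega>)"
proof -
  have "sdde_solution M F W \<tau> f g s (\<lambda>\<omega>. if \<omega> \<in> A then \<zeta> \<omega> else \<eta> \<omega>)
      (\<lambda>t \<omega>. if \<omega> \<in> A then x s \<zeta> t \<omega> else x s \<eta> t \<omega>)"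
    using x F(2) \<zeta> \<eta> by (intro sdde_solution_glue[OF F]) (auto simp: unique_sdde_solution_def)
  also have "(\<lambda>\<omega>. if \<omega> \<in> A then \<zeta> \<omega> else \<eta> \<omega>) = \<eta>" using eq by auto
  finally have "AE \<omega> in M. \<forall>t\<ge>s - \<tau>. (if \<omega> \<in> A then x s \<zeta> t \<omega> else x s \<eta> t \<omega>) = x s \<eta> t \<omega>"
    using x F(2) \<eta> unfolding unique_sdde_solution_def by blast
  then show ?thesis by eventually_elim auto
qed

text \<open>By \<open>measurable_seg_spaceI\<close> it is enough to treat single times
  \<open>s + \<theta>\<close>: from \<open>r\<close> on the solution is adapted, before
  \<open>r\<close> it is read off the datum.\<close>

lemma sdde_segment_measurable:
  assumes F: "usual_filtration M F" "0 \<le> r" "r \<le> s" "0 \<le> \<tau>"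
    and \<xi>: "\<xi> \<in> F r \<rightarrow>\<^sub>M seg_space \<tau>" and y: "sdde_solution M F W \<tau> f g r \<xi> y"
  shows "segment \<tau> y s \<in> F s \<rightarrow>\<^sub>M seg_space \<tau>"
proof (rule measurable_seg_spaceI[OF F(4)])
  have sp: "space (F s) = space M" using usual_filtrationD(2)[OF F(1) _ order_refl] F(2,3) by simp
  have c: "continuous_on {s - \<tau>..s} (\<lambda>u. y u \<omega>)" if "\<omega> \<in> space M" for \<omega>
    using F(3) by (intro continuous_on_subset[OF sdde_solutionD(2)[OF y that]]) auto
  show "segment \<tau> y s \<omega> \<in> seg_set \<tau>" if "\<omega> \<in> space (F s)" for \<omega>
    using segment_in_seg_set[OF F(4) c] that sp by simp
  fix \<theta> assume \<theta>: "\<theta> \<in> {-\<tau>..0}"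
  have "y (s + \<theta>) \<in> borel_measurable (F s)"
  proof (cases "r \<le> s + \<theta>")
    case True
    then show ?thesis
      using measurable_filtration_mono[OF F(1) _ _ sdde_solutionD(3)[OF y True]] \<theta> F(2) by simp
  next
    case False
    have "(\<lambda>\<omega>. apply_bcontfun (\<xi> \<omega>) (s + \<theta> - r)) \<in> borel_measurable (F s)"
      using measurable_compose[OF measurable_filtration_mono[OF F(1-3) \<xi>] measurable_eval_seg] .
    moreover have "apply_bcontfun (\<xi> \<omega>) (s + \<theta> - r) = y (s + \<theta>) \<omega>" if "\<omega> \<in> space (F s)" for \<omega>
      using sdde_solutionD(1)[OF y, of \<omega> "s + \<theta> - r"] that sp False \<theta> F(3) by simp
    ultimately show ?thesis by (simp cong: measurable_cong)
  qed
  then show "(\<lambda>\<omega>. apply_bcontfun (segment \<tau> y s \<omega>) \<theta>) \<in> borel_measurable (F s)"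
    by (rule measurable_cong[THEN iffD1, rotated]) (use segment_apply[where y = y, OF c \<theta>] sp in simp)
qed

text \<open>Subtract the equation at \<open>s\<close> from the equation at \<open>t\<close>; the
  drift integral is additive, and \<open>ito_integral_restart\<close> identifies
  \<open>I t \<omega> - I s \<omega>\<close> as the integral from \<open>s\<close>.\<close>

lemma (in prob_space) sdde_solution_restart:
  fixes y :: "real \<Rightarrow> 'a \<Rightarrow> real^'d"
  assumes F: "usual_filtration M F" "brownian_motion M F W" "0 \<le> r" "r \<le> s" "0 \<le> \<tau>"
    and y: "sdde_solution M F W \<tau> f g r \<xi> y"
  shows "sdde_solution M F W \<tau> f g s (segment \<tau> y s) y"
proof -
  obtain I where I: "ito_integral M F W r (\<lambda>u \<omega>. g (y u \<omega>) (y (u - \<tau>) \<omega>)) I"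
    and Ie: "AE \<omega> in M. \<forall>t\<ge>r. y t \<omega> = apply_bcontfun (\<xi> \<omega>) 0
      + (LINT u:{r..t}|lborel. f (y u \<omega>) (y (u - \<tau>) \<omega>)) + I t \<omega>"
    using sdde_solutionD(5)[OF y] by blast
  have seg: "apply_bcontfun (segment \<tau> y s \<omega>) \<theta> = y (s + \<theta>) \<omega>"
    if "\<omega> \<in> space M" "\<theta> \<in> {-\<tau>..0}" for \<omega> \<theta>
    using F(4) that by (intro segment_apply continuous_on_subset[OF sdde_solutionD(2)[OF y that(1)]]) auto
  have int: "AE \<omega> in M. \<forall>t\<ge>s. set_integrable lborel {s..t} (\<lambda>u. f (y u \<omega>) (y (u - \<tau>) \<omega>))"
    using sdde_solutionD(4)[OF y]
  proof eventually_elim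
    case (elim \<omega>)
    show ?case
    proof (intro allI impI)
      fix t assume "s \<le> t"
      with elim F(4) have "set_integrable lborel {r..t} (\<lambda>u. f (y u \<omega>) (y (u - \<tau>) \<omega>))" by simp
      then show "set_integrable lborel {s..t} (\<lambda>u. f (y u \<omega>) (y (u - \<tau>) \<omega>))"
        by (rule set_integrable_subset) (use F(4) in auto)
    qed
  qed
  have "AE \<omega> in M. \<forall>t\<ge>s. y t \<omega> = apply_bcontfun (segment \<tau> y s \<omega>) 0
      + (LINT u:{s..t}|lborel. f (y u \<omega>) (y (u - \<tau>) \<omega>)) + (I t \<omega> - I s \<omega>)"
    using Ie int sdde_solutionD(4)[OF y] AE_space
  proof eventually_elim
    case (elim \<omega>)
    show ?case
    proof (intro allI impI)
      fix t assume t: "s \<le> t"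
      let ?h = "\<lambda>u. f (y u \<omega>) (y (u - \<tau>) \<omega>)"
      \<comment> \<open>The closed intervals meet in \<open>s\<close>, so they are disjoint only up
        to a null set.\<close>
      have "AE u in lborel. u \<noteq> s" by (rule AE_lborel_singleton)
      then have "AE u in lborel. \<not> (u \<in> {r..s} \<and> u \<in> {s..t})" by eventually_elim auto
      then have "(LINT u:{r..s} \<union> {s..t}|lborel. ?h u) = (LINT u:{r..s}|lborel. ?h u) + (LINT u:{s..t}|lborel. ?h u)"
        using elim(2,3) t F(4) by (intro set_integral_Un_AE) auto
      moreover have "{r..s} \<union> {s..t} = {r..t}" using t F(4) by auto
      moreover have "apply_bcontfun (segment \<tau> y s \<omega>) 0 = y s \<omega>"
        using seg[OF elim(4), of 0] F(5) by simp
      moreover have "y t \<omega> = apply_bcontfun (\<xi> \<omega>) 0 + (LINT u:{r..t}|lborel. ?h u) + I t \<omega>"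
        "y s \<omega> = apply_bcontfun (\<xi> \<omega>) 0 + (LINT u:{r..s}|lborel. ?h u) + I s \<omega>"
        using elim(1) t F(4) by auto
      ultimately show "y t \<omega> = apply_bcontfun (segment \<tau> y s \<omega>) 0
          + (LINT u:{s..t}|lborel. ?h u) + (I t \<omega> - I s \<omega>)"
        by (simp add: algebra_simps)
    qed
  qed
  with ito_integral_restart[OF F(1-4) I]
  have "\<exists>J. ito_integral M F W s (\<lambda>u \<omega>. g (y u \<omega>) (y (u - \<tau>) \<omega>)) J \<and>
       (AE \<omega> in M. \<forall>t\<ge>s. y t \<omega> = apply_bcontfun (segment \<tau> y s \<omega>) 0
         + (LINT u:{s..t}|lborel. f (y u \<omega>) (y (u - \<tau>) \<omega>)) + J t \<omega>)"
    by (intro exI[of _ "\<lambda>t \<omega>. I t \<omega> - I s \<omega>"] conjI)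
  moreover have "continuous_on {s - \<tau>..} (\<lambda>t. y t \<omega>)" if "\<omega> \<in> space M" for \<omega>
    using F(4) by (intro continuous_on_subset[OF sdde_solutionD(2)[OF y that]]) auto
  moreover have "y t \<in> borel_measurable (F t)" if "s \<le> t" for t
    using sdde_solutionD(3)[OF y] that F(4) by simp
  ultimately show ?thesis
    unfolding sdde_solution_def using int by (intro conjI ballI allI impI) (simp_all add: seg)
qed

text \<open>A solution also solves the equation restarted from its own segment, so uniqueness at
  time \<open>s\<close> applies.\<close>

lemma (in prob_space) sdde_flow:
  assumes F: "usual_filtration M F" "brownian_motion M F W" "0 \<le> r" "r \<le> s" "0 \<le> \<tau>"
    and x: "unique_sdde_solution M F W \<tau> f g x" and \<xi>: "\<xi> \<in> F r \<rightarrow>\<^sub>M seg_space \<tau>"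
  shows "segment \<tau> (x r \<xi>) s \<in> F s \<rightarrow>\<^sub>M seg_space \<tau>"
    and "AE \<omega> in M. \<forall>t\<ge>s - \<tau>. x r \<xi> t \<omega> = x s (segment \<tau> (x r \<xi>) s) t \<omega>"
proof -
  have sol: "sdde_solution M F W \<tau> f g r \<xi> (x r \<xi>)"
    using x \<xi> F(3) by (auto simp: unique_sdde_solution_def)
  show *: "segment \<tau> (x r \<xi>) s \<in> F s \<rightarrow>\<^sub>M seg_space \<tau>"
    by (rule sdde_segment_measurable[OF F(1,3,4,5) \<xi> sol])
  have "0 \<le> s" using F by simp
  with * sdde_solution_restart[OF F sol] x
  show "AE \<omega> in M. \<forall>t\<ge>s - \<tau>. x r \<xi> t \<omega> = x s (segment \<tau> (x r \<xi>) s) t \<omega>"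
    unfolding unique_sdde_solution_def by blast
qed

lemma unique_sdde_solution_measurable:
  assumes F: "usual_filtration M F" "0 \<le> s" "s \<le> u" and x: "unique_sdde_solution M F W \<tau> f g x"
    and \<phi>: "\<phi> \<in> F s \<rightarrow>\<^sub>M seg_space \<tau>"
  shows "x s \<phi> u \<in> borel_measurable M"
proof -
  have "sdde_solution M F W \<tau> f g s \<phi> (x s \<phi>)"
    using x \<phi> F(2) by (auto simp: unique_sdde_solution_def)
  from measurable_filtration_ambient[OF F(1) _ sdde_solutionD(3)[OF this F(3)]] show ?thesis
    using F(2,3) by simp
qed

section \<open>Moments and truncation of the data\<close>

text \<open>The norm of the sum is at most twice the larger norm. This avoids convexity and so
  covers all exponents \<open>p \<ge> 0\<close>.\<close>

lemma norm_add_powr_le: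
  fixes a b :: "'b::real_normed_vector"
  assumes "0 \<le> p"
  shows "norm (a + b) powr p \<le> 2 powr p * (norm a powr p + norm b powr p)"
proof -
  have "norm (a + b) powr p \<le> (2 * max (norm a) (norm b)) powr p"
    using norm_triangle_ineq[of a b] by (intro powr_mono2 assms) auto
  also have "\<dots> = 2 powr p * max (norm a) (norm b) powr p" by (rule powr_mult)
  also have "\<dots> \<le> 2 powr p * (norm a powr p + norm b powr p)"
    by (intro mult_left_mono) (auto simp: max_def)
  finally show ?thesis .
qed

lemma moment_add_le:
  fixes Y Z :: "'a \<Rightarrow> 'b::euclidean_space"
  assumes "0 \<le> p" and [measurable]: "Y \<in> borel_measurable M" "Z \<in> borel_measurable M"
  shows "moment M p (\<lambda>\<omega>. Y \<omega> + Z \<omega>) \<le> ennreal (2 powr p) * (moment M p Y + moment M p Z)"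
proof -
  have "moment M p (\<lambda>\<omega>. Y \<omega> + Z \<omega>)
      \<le> (\<integral>\<^sup>+\<omega>. ennreal (2 powr p) * (ennreal (norm (Y \<omega>) powr p) + ennreal (norm (Z \<omega>) powr p)) \<partial>M)"
    unfolding moment_def
    by (intro nn_integral_mono) (simp add: norm_add_powr_le[OF assms(1)] flip: ennreal_plus ennreal_mult)
  also have "\<dots> = ennreal (2 powr p) * (moment M p Y + moment M p Z)"
    unfolding moment_def by (simp add: nn_integral_cmult nn_integral_add)
  finally show ?thesis .
qed

lemma moment_cong_AE: "AE \<omega> in M. Y \<omega> = Z \<omega> \<Longrightarrow> moment M p Y = moment M p Z"
  unfolding moment_def by (rule nn_integral_cong_AE) auto

text \<open>Monotone convergence, in the form in which truncation is removed: a bound that does not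
  depend on the level passes to the full integral.\<close>

lemma nn_integral_le_exhaustion:
  assumes [measurable]: "h \<in> borel_measurable M" "\<And>m. A m \<in> sets M"
    and A: "incseq A" "AE \<omega> in M. \<exists>m::nat. \<omega> \<in> A m"
    and le: "\<And>m. (\<integral>\<^sup>+\<omega>\<in>A m. h \<omega> \<partial>M) \<le> B"
  shows "(\<integral>\<^sup>+\<omega>. h \<omega> \<partial>M) \<le> B"
proof -
  have "(\<integral>\<^sup>+\<omega>. h \<omega> \<partial>M) \<le> (\<integral>\<^sup>+\<omega>. (SUP m. h \<omega> * indicator (A m) \<omega>) \<partial>M)"
  proof (rule nn_integral_mono_AE)
    show "AE \<omega> in M. h \<omega> \<le> (SUP m. h \<omega> * indicator (A m) \<omega>)"
      using A(2)
    proof eventually_elim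
      case (elim \<omega>)
      then obtain m where "\<omega> \<in> A m" by blast
      then show ?case by (intro SUP_upper2[of m]) auto
    qed
  qed
  also have "\<dots> = (SUP m. \<integral>\<^sup>+\<omega>\<in>A m. h \<omega> \<partial>M)"
  proof (rule nn_integral_monotone_convergence_SUP)
    show "incseq (\<lambda>m \<omega>. h \<omega> * indicator (A m) \<omega>)"
      using A(1) by (force simp: incseq_def le_fun_def indicator_def)
  qed measurable
  also have "\<dots> \<le> B" using le by (rule SUP_least)
  finally show ?thesis .
qed

lemma measurable_seg_truncate:
  assumes "\<eta> \<in> N \<rightarrow>\<^sub>M seg_space \<tau>" "A \<in> sets N"
  shows "(\<lambda>\<omega>. if \<omega> \<in> A then \<eta> \<omega> else 0) \<in> N \<rightarrow>\<^sub>M seg_space \<tau>"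
  using assms by (intro measurable_If_set) (auto simp: space_seg_space zero_in_seg_set)

text \<open>A contraction estimate for data with values in a compact set extends to all data: by tightness
  the data lie in compact sets on events that exhaust the space, and the solution is local there.\<close>

lemma (in prob_space) sdde_contraction:
  assumes F: "usual_filtration M F" "0 \<le> s" "0 \<le> \<tau>" and u: "s \<le> u"
    and x: "unique_sdde_solution M F W \<tau> f g x"
    and compact: "\<And>K \<zeta> \<eta>. compact K \<Longrightarrow> K \<subseteq> seg_set \<tau> \<Longrightarrow>
         \<zeta> \<in> F s \<rightarrow>\<^sub>M seg_space \<tau> \<Longrightarrow> \<eta> \<in> F s \<rightarrow>\<^sub>M seg_space \<tau> \<Longrightarrow>
         \<zeta> ` space M \<subseteq> K \<Longrightarrow> \<eta> ` space M \<subseteq> K \<Longrightarrow>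
         moment M p (\<lambda>\<omega>. x s \<zeta> u \<omega> - x s \<eta> u \<omega>)
         \<le> c * (SUP \<theta>\<in>{-\<tau>..0}. moment M p (\<lambda>\<omega>. apply_bcontfun (\<zeta> \<omega>) \<theta> - apply_bcontfun (\<eta> \<omega>) \<theta>))"
    and \<zeta>: "\<zeta> \<in> F s \<rightarrow>\<^sub>M seg_space \<tau>" and \<eta>: "\<eta> \<in> F s \<rightarrow>\<^sub>M seg_space \<tau>"
  shows "moment M p (\<lambda>\<omega>. x s \<zeta> u \<omega> - x s \<eta> u \<omega>)
         \<le> c * (SUP \<theta>\<in>{-\<tau>..0}. moment M p (\<lambda>\<omega>. apply_bcontfun (\<zeta> \<omega>) \<theta> - apply_bcontfun (\<eta> \<omega>) \<theta>))"
proof -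
  have sp: "space (F s) = space M" using usual_filtrationD(2)[OF F(1,2) order_refl] .
  obtain K where K: "\<And>m. compact (K m)" "\<And>m. K m \<subseteq> seg_set \<tau>" "incseq K" "AE \<omega> in M. \<exists>m::nat. \<zeta> \<omega> \<in> K m"
    using seg_tight[OF F(3) measurable_filtration_ambient[OF F(1,2) \<zeta>]] by blast
  obtain L where L: "\<And>m. compact (L m)" "\<And>m. L m \<subseteq> seg_set \<tau>" "incseq L" "AE \<omega> in M. \<exists>m::nat. \<eta> \<omega> \<in> L m"
    using seg_tight[OF F(3) measurable_filtration_ambient[OF F(1,2) \<eta>]] by blast
  define A where "A m = {\<omega> \<in> space M. \<zeta> \<omega> \<in> K m \<and> \<eta> \<omega> \<in> L m}" for m
  have [measurable]: "K m \<in> sets borel" "L m \<in> sets borel" for m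
    using K(1) L(1) by (auto intro: borel_closed compact_imp_closed)
  have [measurable]: "\<zeta> \<in> borel_measurable (F s)" "\<eta> \<in> borel_measurable (F s)"
    using \<zeta> \<eta> by (auto intro: measurable_seg_space_borel)
  have "{\<omega> \<in> space (F s). \<zeta> \<omega> \<in> K m \<and> \<eta> \<omega> \<in> L m} \<in> sets (F s)" for m by measurable
  then have A: "A m \<in> sets (F s)" for m by (simp add: A_def sp)
  have AM: "A m \<in> sets M" for m
    using A usual_filtrationD(1)[OF F(1,2) order_refl] by (auto simp: subalgebra_def)
  let ?e = "\<lambda>\<theta>. moment M p (\<lambda>\<omega>. apply_bcontfun (\<zeta> \<omega>) \<theta> - apply_bcontfun (\<eta> \<omega>) \<theta>)"
  have [measurable]: "x s \<zeta> u \<in> borel_measurable M" "x s \<eta> u \<in> borel_measurable M"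
    using unique_sdde_solution_measurable[OF F(1,2) u x] \<zeta> \<eta> by auto
  show ?thesis
    unfolding moment_def[of M p "\<lambda>\<omega>. x s \<zeta> u \<omega> - x s \<eta> u \<omega>"]
  proof (rule nn_integral_le_exhaustion[OF _ AM])
    show "(\<lambda>\<omega>. ennreal (norm (x s \<zeta> u \<omega> - x s \<eta> u \<omega>) powr p)) \<in> borel_measurable M" by measurable
    show "incseq A"
      using incseqD[OF K(3)] incseqD[OF L(3)] by (fastforce simp: A_def incseq_def)
    show "AE \<omega> in M. \<exists>m. \<omega> \<in> A m"
      using K(4) L(4) AE_space
    proof eventually_elim
      case (elim \<omega>)
      then obtain i j where "\<zeta> \<omega> \<in> K i" "\<eta> \<omega> \<in> L j" by blast
      then have "\<zeta> \<omega> \<in> K (max i j)" "\<eta> \<omega> \<in> L (max i j)"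
        using incseqD[OF K(3), of i "max i j"] incseqD[OF L(3), of j "max i j"] by auto
      with elim(3) show ?case by (auto simp: A_def)
    qed
    fix m
    \<comment> \<open>Both data become 0 off the same event. Their difference vanishes there, so the
      right-hand side for the truncated data is at most the one for the original data.\<close>
    define \<zeta>' \<eta>' where "\<zeta>' = (\<lambda>\<omega>. if \<omega> \<in> A m then \<zeta> \<omega> else 0)" and "\<eta>' = (\<lambda>\<omega>. if \<omega> \<in> A m then \<eta> \<omega> else 0)"
    have m': "\<zeta>' \<in> F s \<rightarrow>\<^sub>M seg_space \<tau>" "\<eta>' \<in> F s \<rightarrow>\<^sub>M seg_space \<tau>"
      unfolding \<zeta>'_def \<eta>'_def using \<zeta> \<eta> A by (auto intro: measurable_seg_truncate)
    have "AE \<omega> in M. \<omega> \<in> A m \<longrightarrow> (\<forall>t\<ge>s - \<tau>. x s \<zeta> t \<omega> = x s \<zeta>' t \<omega>)"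
      by (rule sdde_solution_local[OF F(1,2) A x \<zeta> m'(1)]) (simp add: \<zeta>'_def)
    moreover have "AE \<omega> in M. \<omega> \<in> A m \<longrightarrow> (\<forall>t\<ge>s - \<tau>. x s \<eta> t \<omega> = x s \<eta>' t \<omega>)"
      by (rule sdde_solution_local[OF F(1,2) A x \<eta> m'(2)]) (simp add: \<eta>'_def)
    ultimately have "(\<integral>\<^sup>+\<omega>\<in>A m. ennreal (norm (x s \<zeta> u \<omega> - x s \<eta> u \<omega>) powr p) \<partial>M)
        \<le> moment M p (\<lambda>\<omega>. x s \<zeta>' u \<omega> - x s \<eta>' u \<omega>)"
      unfolding moment_def
    proof (intro nn_integral_mono_AE, eventually_elim)
      case (elim \<omega>) then show ?case using u F(3) by (cases "\<omega> \<in> A m") auto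
    qed
    also have "\<dots> \<le> c * (SUP \<theta>\<in>{-\<tau>..0}. moment M p (\<lambda>\<omega>. apply_bcontfun (\<zeta>' \<omega>) \<theta> - apply_bcontfun (\<eta>' \<omega>) \<theta>))"
    proof (rule compact[OF _ _ m'])
      \<comment> \<open>The default value 0 has to belong to the compact set as well.\<close>
      show "compact (insert 0 (K m \<union> L m))" using K(1) L(1) by (intro compact_insert compact_Un)
    qed (use K(2) L(2) zero_in_seg_set in \<open>auto simp: \<zeta>'_def \<eta>'_def A_def\<close>)
    also have "\<dots> \<le> c * (SUP \<theta>\<in>{-\<tau>..0}. ?e \<theta>)"
      unfolding moment_def
      by (intro mult_left_mono SUP_mono' nn_integral_mono) (auto simp: \<zeta>'_def \<eta>'_def)
    finally show "(\<integral>\<^sup>+\<omega>\<in>A m. ennreal (norm (x s \<zeta> u \<omega> - x s \<eta> u \<omega>) powr p) \<partial>M)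
        \<le> c * (SUP \<theta>\<in>{-\<tau>..0}. ?e \<theta>)" .
  qed
qed

text \<open>Only segments at grid times are known to be measurable. The value at \<open>t\<close> is
  read off the segment at the next grid time, whose window reaches back to \<open>t\<close> because
  \<open>\<Delta> \<le> \<tau>\<close>.\<close>

lemma numerical_solution_measurable:
  assumes F: "usual_filtration M F" and X: "numerical_solution M F \<tau> \<Delta> X" and \<Delta>: "0 < \<Delta>" "\<Delta> \<le> \<tau>"
    and \<eta>: "\<eta> \<in> F (real k * \<Delta>) \<rightarrow>\<^sub>M seg_space \<tau>" and t: "real k * \<Delta> \<le> t"
  shows "X (real k * \<Delta>) \<eta> t \<in> borel_measurable M"
proof -
  define j where "j = nat \<lceil>t / \<Delta>\<rceil>"
  have kt: "real k \<le> t / \<Delta>" using t \<Delta>(1) by (simp add: pos_le_divide_eq)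
  then have "- 1 < t / \<Delta>" by linarith
  then have j: "real j = of_int \<lceil>t / \<Delta>\<rceil>" by (simp add: j_def)
  have "t / \<Delta> \<le> real j" "real j < t / \<Delta> + 1" unfolding j by linarith+
  then have jt: "t \<le> real j * \<Delta>" "real j * \<Delta> < t + \<Delta>" using \<Delta>(1) by (simp_all add: field_simps)
  have kj: "k \<le> j" using kt \<open>t / \<Delta> \<le> real j\<close> by linarith
  have "segment \<tau> (X (real k * \<Delta>) \<eta>) (real j * \<Delta>) \<in> F (real j * \<Delta>) \<rightarrow>\<^sub>M seg_space \<tau>"
    using X \<eta> kj by (auto simp: numerical_solution_def)
  then have "segment \<tau> (X (real k * \<Delta>) \<eta>) (real j * \<Delta>) \<in> M \<rightarrow>\<^sub>M seg_space \<tau>"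
    by (rule measurable_filtration_ambient[OF F, rotated]) (use \<Delta>(1) in simp)
  from measurable_compose[OF this measurable_eval_seg]
  have "(\<lambda>\<omega>. apply_bcontfun (segment \<tau> (X (real k * \<Delta>) \<eta>) (real j * \<Delta>) \<omega>) (t - real j * \<Delta>)) \<in> borel_measurable M" .
  moreover have "apply_bcontfun (segment \<tau> (X (real k * \<Delta>) \<eta>) (real j * \<Delta>) \<omega>) (t - real j * \<Delta>) = X (real k * \<Delta>) \<eta> t \<omega>"
    if "\<omega> \<in> space M" for \<omega>
  proof -
    have "continuous_on {real k * \<Delta> - \<tau>..} (\<lambda>t. X (real k * \<Delta>) \<eta> t \<omega>)"
      using X \<eta> that by (auto simp: numerical_solution_def)
    then have "continuous_on {real j * \<Delta> - \<tau>..real j * \<Delta>} (\<lambda>t. X (real k * \<Delta>) \<eta> t \<omega>)"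
      by (rule continuous_on_subset) (use kj \<Delta>(1) in \<open>auto simp: mult_right_mono intro: order_trans[rotated]\<close>)
    from segment_apply[where y = "X (real k * \<Delta>) \<eta>", OF this, of "t - real j * \<Delta>"] show ?thesis using jt \<Delta> by simp
  qed
  ultimately show ?thesis by (simp cong: measurable_cong)
qed

text \<open>Cut the datum to 0 where its norm exceeds \<open>m\<close>. On the remaining event both
  solutions are unchanged, the exact one by \<open>sdde_solution_local\<close> and the numerical one
  by the last clause of \<open>numerical_solution\<close>, and the \<open>r\<close>-th moments of
  the datum can only drop.\<close>

lemma (in prob_space) numerical_error_unbounded_data:
  assumes F: "usual_filtration M F" "0 \<le> \<tau>" and X: "numerical_solution M F \<tau> \<Delta> X" and \<Delta>: "0 < \<Delta>" "\<Delta> \<le> \<tau>"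
    and s: "s = real k * \<Delta>" "s \<le> u"
    and x: "unique_sdde_solution M F W \<tau> f g x"
    and bdd: "\<And>\<eta>. \<eta> \<in> F s \<rightarrow>\<^sub>M seg_space \<tau> \<Longrightarrow> ess_bounded M \<eta> \<Longrightarrow>
         moment M p (\<lambda>\<omega>. x s \<eta> u \<omega> - X s \<eta> u \<omega>)
         \<le> c * (1 + (SUP \<theta>\<in>{-\<tau>..0}. moment M r (\<lambda>\<omega>. apply_bcontfun (\<eta> \<omega>) \<theta>))) * d"
    and \<eta>: "\<eta> \<in> F s \<rightarrow>\<^sub>M seg_space \<tau>"
  shows "moment M p (\<lambda>\<omega>. x s \<eta> u \<omega> - X s \<eta> u \<omega>)
         \<le> c * (1 + (SUP \<theta>\<in>{-\<tau>..0}. moment M r (\<lambda>\<omega>. apply_bcontfun (\<eta> \<omega>) \<theta>))) * d"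
proof -
  have s0: "0 \<le> s" using s \<Delta> by simp
  have sp: "space (F s) = space M" using usual_filtrationD(2)[OF F(1) s0 order_refl] .
  define A where "A m = {\<omega> \<in> space M. norm (\<eta> \<omega>) \<le> real m}" for m
  have [measurable]: "\<eta> \<in> borel_measurable (F s)" using \<eta> by (rule measurable_seg_space_borel)
  have "{\<omega> \<in> space (F s). norm (\<eta> \<omega>) \<le> real m} \<in> sets (F s)" for m by measurable
  then have A: "A m \<in> sets (F s)" for m by (simp add: A_def sp)
  have AM: "A m \<in> sets M" for m
    using A usual_filtrationD(1)[OF F(1) s0 order_refl] by (auto simp: subalgebra_def)
  have [measurable]: "x s \<eta> u \<in> borel_measurable M"
    by (rule unique_sdde_solution_measurable[OF F(1) s0 s(2) x \<eta>])
  have [measurable]: "X s \<eta> u \<in> borel_measurable M"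
    using numerical_solution_measurable[OF F(1) X \<Delta>, of \<eta> k u] \<eta> s by simp
  show ?thesis
    unfolding moment_def[of M p "\<lambda>\<omega>. x s \<eta> u \<omega> - X s \<eta> u \<omega>"]
  proof (rule nn_integral_le_exhaustion[OF _ AM])
    show "(\<lambda>\<omega>. ennreal (norm (x s \<eta> u \<omega> - X s \<eta> u \<omega>) powr p)) \<in> borel_measurable M" by measurable
    show "incseq A" by (fastforce simp: A_def incseq_def)
    show "AE \<omega> in M. \<exists>m. \<omega> \<in> A m" using AE_space by eventually_elim (simp add: A_def real_arch_simple)
    fix m
    define \<eta>' where "\<eta>' = (\<lambda>\<omega>. if \<omega> \<in> A m then \<eta> \<omega> else 0)"
    have m': "\<eta>' \<in> F s \<rightarrow>\<^sub>M seg_space \<tau>"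
      unfolding \<eta>'_def using \<eta> A by (rule measurable_seg_truncate)
    have "AE \<omega> in M. \<omega> \<in> A m \<longrightarrow> (\<forall>t\<ge>s - \<tau>. x s \<eta> t \<omega> = x s \<eta>' t \<omega>)"
      by (rule sdde_solution_local[OF F(1) s0 A x \<eta> m']) (simp add: \<eta>'_def)
    moreover have "AE \<omega> in M. \<eta> \<omega> = \<eta>' \<omega> \<longrightarrow> X s \<eta> u \<omega> = X s \<eta>' u \<omega>"
      using X \<eta> m' s by (auto simp: numerical_solution_def)
    ultimately have "(\<integral>\<^sup>+\<omega>\<in>A m. ennreal (norm (x s \<eta> u \<omega> - X s \<eta> u \<omega>) powr p) \<partial>M)
        \<le> moment M p (\<lambda>\<omega>. x s \<eta>' u \<omega> - X s \<eta>' u \<omega>)"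
      unfolding moment_def
    proof (intro nn_integral_mono_AE, eventually_elim)
      case (elim \<omega>) then show ?case using s(2) F(2) by (cases "\<omega> \<in> A m") (auto simp: \<eta>'_def)
    qed
    also have "norm (\<eta>' \<omega>) \<le> real m" for \<omega> by (auto simp: \<eta>'_def A_def)
    then have "ess_bounded M \<eta>'" unfolding ess_bounded_def by auto
    note bdd[OF m' this]
    also have "c * (1 + (SUP \<theta>\<in>{-\<tau>..0}. moment M r (\<lambda>\<omega>. apply_bcontfun (\<eta>' \<omega>) \<theta>))) * d
        \<le> c * (1 + (SUP \<theta>\<in>{-\<tau>..0}. moment M r (\<lambda>\<omega>. apply_bcontfun (\<eta> \<omega>) \<theta>))) * d"
      unfolding moment_def
      by (intro mult_left_mono mult_right_mono add_left_mono SUP_mono' nn_integral_mono) (auto simp: \<eta>'_def)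
    finally show "(\<integral>\<^sup>+\<omega>\<in>A m. ennreal (norm (x s \<eta> u \<omega> - X s \<eta> u \<omega>) powr p) \<partial>M)
        \<le> c * (1 + (SUP \<theta>\<in>{-\<tau>..0}. moment M r (\<lambda>\<omega>. apply_bcontfun (\<eta> \<omega>) \<theta>))) * d" .
  qed
qed

section \<open>Infinite horizon convergence\<close>

theorem theorem3p3:
  fixes M :: "'a measure" and F :: "real \<Rightarrow> 'a measure" and W :: "real \<Rightarrow> 'a \<Rightarrow> real^'m"
    and \<tau> :: real
    and f :: "real^'d \<Rightarrow> real^'d \<Rightarrow> real^'d" and g :: "real^'d \<Rightarrow> real^'d \<Rightarrow> real^'m^'d"
    and x :: "real \<Rightarrow> ('a \<Rightarrow> (real \<Rightarrow>\<^sub>C (real^'d))) \<Rightarrow> real \<Rightarrow> 'a \<Rightarrow> real^'d"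
    and X :: "nat \<Rightarrow> real \<Rightarrow> ('a \<Rightarrow> (real \<Rightarrow>\<^sub>C (real^'d))) \<Rightarrow> real \<Rightarrow> 'a \<Rightarrow> real^'d"
    and \<Delta> :: "nat \<Rightarrow> real"
    and \<xi> :: "'a \<Rightarrow> (real \<Rightarrow>\<^sub>C (real^'d))"
    and p q r M\<^sub>1 M\<^sub>2 M\<^sub>3 :: real and C :: "real \<Rightarrow> real"
  assumes "prob_space M" and "usual_filtration M F" and "brownian_motion M F W"
    and "\<tau> > 0"
    and "(\<lambda>(u, v). f u v) \<in> borel_measurable borel"
    and "(\<lambda>(u, v). g u v) \<in> borel_measurable borel"
    and "unique_sdde_solution M F W \<tau> f g x"
    and step_size: "\<And>N. \<Delta> N = \<tau> / real N"
    and "\<xi> \<in> F 0 \<rightarrow>\<^sub>M seg_space \<tau>" and "ess_bounded M \<xi>"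
    and "p > 0" and "r > 0" and "q > 0"
    and i: "\<And>N. N \<ge> 1 \<Longrightarrow> numerical_solution M F \<tau> (\<Delta> N) (X N)"
      "\<And>N. N \<ge> 1 \<Longrightarrow> homogeneous_markov_chain M (seg_space \<tau>)
         (\<lambda>k. segment \<tau> (X N 0 \<xi>) (real k * \<Delta> N))"
    and ii: "M\<^sub>1 > 0"
      "\<And>N t. N \<ge> 1 \<Longrightarrow> t \<ge> -\<tau> \<Longrightarrow> moment M r (X N 0 \<xi> t) \<le> ennreal M\<^sub>1"
    and iii: "M\<^sub>2 > 0" "M\<^sub>3 > 0"
      "\<And>K s \<zeta> \<eta> t. compact K \<Longrightarrow> K \<subseteq> seg_set \<tau> \<Longrightarrow> s \<ge> 0 \<Longrightarrow>
         \<zeta> \<in> F s \<rightarrow>\<^sub>M seg_space \<tau> \<Longrightarrow> \<eta> \<in> F s \<rightarrow>\<^sub>M seg_space \<tau> \<Longrightarrow>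
         \<zeta> ` space M \<subseteq> K \<Longrightarrow> \<eta> ` space M \<subseteq> K \<Longrightarrow> t \<ge> 0 \<Longrightarrow>
         moment M p (\<lambda>\<omega>. x s \<zeta> (s + t) \<omega> - x s \<eta> (s + t) \<omega>)
         \<le> ennreal M\<^sub>2
             * (SUP \<theta>\<in>{-\<tau>..0}. moment M p (\<lambda>\<omega>. apply_bcontfun (\<zeta> \<omega>) \<theta> - apply_bcontfun (\<eta> \<omega>) \<theta>))
             * ennreal (exp (- M\<^sub>3 * t))"
    and iv: "\<And>h. C h \<ge> 0"
      "\<And>N k\<^sub>1 k\<^sub>2 T\<^sub>1 T\<^sub>2 \<eta>. N \<ge> 1 \<Longrightarrow> T\<^sub>1 = real k\<^sub>1 * \<Delta> N \<Longrightarrow> T\<^sub>2 = real k\<^sub>2 * \<Delta> N \<Longrightarrow> T\<^sub>1 < T\<^sub>2 \<Longrightarrow>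
         \<eta> \<in> F T\<^sub>1 \<rightarrow>\<^sub>M seg_space \<tau> \<Longrightarrow> ess_bounded M \<eta> \<Longrightarrow>
         (SUP t\<in>{T\<^sub>1..T\<^sub>2}. moment M p (\<lambda>\<omega>. x T\<^sub>1 \<eta> t \<omega> - X N T\<^sub>1 \<eta> t \<omega>))
         \<le> ennreal (C (T\<^sub>2 - T\<^sub>1))
             * (1 + (SUP \<theta>\<in>{-\<tau>..0}. moment M r (\<lambda>\<omega>. apply_bcontfun (\<eta> \<omega>) \<theta>)))
             * ennreal (\<Delta> N powr q)"
  shows "\<exists>\<K>>0. \<forall>N\<ge>1. \<forall>t\<ge>-\<tau>.
           moment M p (\<lambda>\<omega>. x 0 \<xi> t \<omega> - X N 0 \<xi> t \<omega>) \<le> ennreal (\<K> * \<Delta> N powr q)"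
proof -
  interpret prob_space M by fact
  note F = assms(2) and \<tau> = assms(4) and x = assms(7) and \<xi> = assms(9) and p = \<open>p > 0\<close>
  define Z where "Z N t \<omega> = x 0 \<xi> t \<omega> - X N 0 \<xi> t \<omega>" for N t \<omega>
  \<comment> \<open>The supremum stands outside the moment, as on the right of \<open>iii\<close>.
    Working at fixed times also suits the numerical flow property, whose null set depends on
    \<open>t\<close>. Values are in \<open>ennreal\<close>, as finiteness is only established by the
    induction.\<close>
  define E where "E N s = (SUP \<theta>\<in>{-\<tau>..0}. moment M p (Z N (s + \<theta>)))" for N s
  \<comment> \<open>The choice makes \<open>2 powr p * M\<^sub>2 * exp (- M\<^sub>3 * h)\<close> at
    most \<open>1/2\<close> once \<open>h\<close> is at least
    \<open>real m * \<tau>\<close>.\<close>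
  obtain m :: nat where m: "ln (2 * (2 powr p * M\<^sub>2)) < real m * (M\<^sub>3 * \<tau>)"
    using reals_Archimedean3[of "M\<^sub>3 * \<tau>"] iii(2) \<tau> by auto
  \<comment> \<open>One extra \<open>\<tau>\<close> pays for the length of a segment. The other
    gives \<open>\<tau> < T\<close> even for \<open>m = 0\<close>, so that the segment ending a
    block lies strictly after its start.\<close>
  define T where "T = real (m + 2) * \<tau>"
  have "T = \<tau> + real (m + 1) * \<tau>" "0 < real (m + 1) * \<tau>" using \<tau> by (auto simp: T_def algebra_simps add_pos_nonneg)
  then have T: "\<tau> < T" "0 < T" using \<tau> by linarith+
  have half: "2 powr p * M\<^sub>2 * exp (- M\<^sub>3 * h) \<le> 1/2" if "T - \<tau> \<le> h" for h
  proof -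
    have "real m * \<tau> \<le> h" using that \<tau> by (simp add: T_def algebra_simps)
    then have "real m * (M\<^sub>3 * \<tau>) \<le> M\<^sub>3 * h"
      using mult_left_mono[of "real m * \<tau>" h M\<^sub>3] iii(2) by (simp add: ac_simps)
    with m have "exp (ln (2 * (2 powr p * M\<^sub>2))) \<le> exp (M\<^sub>3 * h)" by simp
    then have "2 * (2 powr p * M\<^sub>2) \<le> exp (M\<^sub>3 * h)" using iii(1) by (subst (asm) exp_ln) auto
    then show ?thesis by (simp add: exp_minus field_simps)
  qed
  \<comment> \<open>The contribution of one block to the error: the constant of \<open>iv\<close>
    for length \<open>T\<close>, with the moments of the restart datum bounded by
    \<open>M\<^sub>1\<close>, times the factor from splitting the error.\<close>
  define b where "b = 2 powr p * (C T * (1 + M\<^sub>1))"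
  have b: "0 \<le> b" using iv(1) ii(1) by (simp add: b_def)

  have zero: "moment M p (Z N t) = 0" if N: "N \<ge> 1" and t: "t \<in> {-\<tau>..0}" for N t
  proof -
    have "\<forall>\<omega>\<in>space M. Z N t \<omega> = 0"
    proof
      fix \<omega> assume \<omega>: "\<omega> \<in> space M"
      have "sdde_solution M F W \<tau> f g 0 \<xi> (x 0 \<xi>)" using x \<xi> by (auto simp: unique_sdde_solution_def)
      from sdde_solutionD(1)[OF this \<omega> t] have "x 0 \<xi> t \<omega> = apply_bcontfun (\<xi> \<omega>) t" by simp
      moreover have "X N (real 0 * \<Delta> N) \<xi> (real 0 * \<Delta> N + t) \<omega> = apply_bcontfun (\<xi> \<omega>) t"
        using i(1)[OF N, unfolded numerical_solution_def, THEN conjunct1, rule_format, of \<xi> 0] \<xi> \<omega> t by simp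
      ultimately show "Z N t \<omega> = 0" by (simp add: Z_def)
    qed
    then have "moment M p (Z N t) = moment M p (\<lambda>_. 0 :: real^'d)"
      by (intro moment_cong_AE AE_I2) auto
    then show ?thesis by (simp add: moment_def)
  qed

  \<comment> \<open>The decay factor is kept explicit: at the end of a block it is estimated by
    \<open>half\<close>, at an arbitrary time merely by 1.\<close>
  have step: "moment M p (Z N t) \<le> ennreal (2 powr p * M\<^sub>2 * exp (- M\<^sub>3 * (t - s)) * e + b * \<Delta> N powr q)"
    if N: "N \<ge> 1" and s: "s = real k * T" and t: "s < t" "t \<le> s + T"
      and e: "E N s \<le> ennreal e" "0 \<le> e" for N k s t e
  proof -
    have \<Delta>: "0 < \<Delta> N" "\<Delta> N \<le> \<tau>" "\<tau> = real N * \<Delta> N" using N \<tau> by (auto simp: step_size field_simps)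
    \<comment> \<open>Since \<open>\<tau>\<close> is \<open>N\<close> steps, a block of length
      \<open>T\<close> is \<open>(m + 2) * N\<close> steps, and block boundaries are grid times for
      every \<open>N\<close>.\<close>
    define k1 where "k1 = k * (m + 2) * N"
    define k2 where "k2 = Suc k * (m + 2) * N"
    have s1: "s = real k1 * \<Delta> N" unfolding s T_def k1_def by (subst \<Delta>(3)) (simp add: algebra_simps)
    have s2: "s + T = real k2 * \<Delta> N" unfolding s T_def k2_def by (subst (1 2) \<Delta>(3)) (simp add: algebra_simps)
    have s0: "0 \<le> s" using s T by simp
    define \<zeta> where "\<zeta> = segment \<tau> (x 0 \<xi>) s"
    define \<eta> where "\<eta> = segment \<tau> (X N 0 \<xi>) s"
    have sol: "sdde_solution M F W \<tau> f g 0 \<xi> (x 0 \<xi>)" using x \<xi> by (auto simp: unique_sdde_solution_def)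
    have \<zeta>: "\<zeta> \<in> F s \<rightarrow>\<^sub>M seg_space \<tau>"
      and x_flow: "AE \<omega> in M. \<forall>t\<ge>s - \<tau>. x 0 \<xi> t \<omega> = x s \<zeta> t \<omega>"
      using sdde_flow[OF F assms(3) order_refl s0 _ x \<xi>] \<tau> by (auto simp: \<zeta>_def)
    note num = i(1)[OF N, unfolded numerical_solution_def]
    have X0: "\<forall>\<omega>\<in>space M. continuous_on {- \<tau>..} (\<lambda>t. X N 0 \<xi> t \<omega>)"
      "segment \<tau> (X N 0 \<xi>) (real k1 * \<Delta> N) \<in> F (real k1 * \<Delta> N) \<rightarrow>\<^sub>M seg_space \<tau>"
      using num[THEN conjunct1, rule_format, of \<xi> 0] \<xi> by auto
    have \<eta>: "\<eta> \<in> F s \<rightarrow>\<^sub>M seg_space \<tau>" using X0(2) by (simp add: \<eta>_def s1)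
    have X_flow: "AE \<omega> in M. X N 0 \<xi> t \<omega> = X N s \<eta> t \<omega>"
      using num[THEN conjunct2, THEN conjunct1, rule_format, of \<xi> k1 t] \<xi> t(1) by (simp add: \<eta>_def s1)
    have \<zeta>_eval: "apply_bcontfun (\<zeta> \<omega>) \<theta> = x 0 \<xi> (s + \<theta>) \<omega>"
      if "\<omega> \<in> space M" "\<theta> \<in> {-\<tau>..0}" for \<omega> \<theta>
      unfolding \<zeta>_def using s0 that
      by (intro segment_apply continuous_on_subset[OF sdde_solutionD(2)[OF sol that(1)]]) auto
    have \<eta>_eval: "apply_bcontfun (\<eta> \<omega>) \<theta> = X N 0 \<xi> (s + \<theta>) \<omega>"
      if "\<omega> \<in> space M" "\<theta> \<in> {-\<tau>..0}" for \<omega> \<theta>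
      unfolding \<eta>_def using s0 that
      by (intro segment_apply continuous_on_subset[OF X0(1)[rule_format, OF that(1)]]) auto

    have "moment M p (\<lambda>\<omega>. x s \<zeta> t \<omega> - x s \<eta> t \<omega>)
        \<le> ennreal (M\<^sub>2 * exp (- M\<^sub>3 * (t - s)))
          * (SUP \<theta>\<in>{-\<tau>..0}. moment M p (\<lambda>\<omega>. apply_bcontfun (\<zeta> \<omega>) \<theta> - apply_bcontfun (\<eta> \<omega>) \<theta>))"
    proof (rule sdde_contraction[OF F s0 _ _ x _ \<zeta> \<eta>])
      fix K and \<phi> \<psi> :: "'a \<Rightarrow> real \<Rightarrow>\<^sub>C (real^'d)"
      assume *: "compact K" "K \<subseteq> seg_set \<tau>" "\<phi> \<in> F s \<rightarrow>\<^sub>M seg_space \<tau>" "\<psi> \<in> F s \<rightarrow>\<^sub>M seg_space \<tau>"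
        "\<phi> ` space M \<subseteq> K" "\<psi> ` space M \<subseteq> K"
      show "moment M p (\<lambda>\<omega>. x s \<phi> t \<omega> - x s \<psi> t \<omega>) \<le> ennreal (M\<^sub>2 * exp (- M\<^sub>3 * (t - s)))
          * (SUP \<theta>\<in>{-\<tau>..0}. moment M p (\<lambda>\<omega>. apply_bcontfun (\<phi> \<omega>) \<theta> - apply_bcontfun (\<psi> \<omega>) \<theta>))"
        using iii(3)[OF *(1,2) s0 *(3-6), of "t - s"] t(1) iii(1) by (simp add: ennreal_mult ac_simps)
    qed (use \<tau> t in auto)
    also have "(SUP \<theta>\<in>{-\<tau>..0}. moment M p (\<lambda>\<omega>. apply_bcontfun (\<zeta> \<omega>) \<theta> - apply_bcontfun (\<eta> \<omega>) \<theta>)) = E N s"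
      unfolding E_def by (intro SUP_cong refl moment_cong_AE AE_I2) (simp add: \<zeta>_eval \<eta>_eval Z_def)
    also have "ennreal (M\<^sub>2 * exp (- M\<^sub>3 * (t - s))) * E N s \<le> ennreal (M\<^sub>2 * exp (- M\<^sub>3 * (t - s))) * ennreal e"
      using e(1) by (rule mult_left_mono) simp
    finally have first: "moment M p (\<lambda>\<omega>. x s \<zeta> t \<omega> - x s \<eta> t \<omega>) \<le> ennreal (M\<^sub>2 * exp (- M\<^sub>3 * (t - s)) * e)"
      using e(2) iii(1) by (simp add: ennreal_mult)

    \<comment> \<open>Applying \<open>iv\<close> to the whole block gives the constant
      \<open>C T\<close>, whatever the position \<open>k\<close> of the block.\<close>
    have "moment M p (\<lambda>\<omega>. x s \<eta> t \<omega> - X N s \<eta> t \<omega>)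
        \<le> ennreal (C T) * (1 + (SUP \<theta>\<in>{-\<tau>..0}. moment M r (\<lambda>\<omega>. apply_bcontfun (\<eta> \<omega>) \<theta>))) * ennreal (\<Delta> N powr q)"
    proof (rule numerical_error_unbounded_data[OF F _ i(1)[OF N] \<Delta>(1,2) s1 _ x _ \<eta>])
      fix \<phi> :: "'a \<Rightarrow> real \<Rightarrow>\<^sub>C (real^'d)" assume \<phi>: "\<phi> \<in> F s \<rightarrow>\<^sub>M seg_space \<tau>" "ess_bounded M \<phi>"
      have "moment M p (\<lambda>\<omega>. x s \<phi> t \<omega> - X N s \<phi> t \<omega>)
          \<le> (SUP t\<in>{s..s + T}. moment M p (\<lambda>\<omega>. x s \<phi> t \<omega> - X N s \<phi> t \<omega>))"
        using t by (intro SUP_upper) auto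
      also have "\<dots> \<le> ennreal (C (s + T - s))
          * (1 + (SUP \<theta>\<in>{-\<tau>..0}. moment M r (\<lambda>\<omega>. apply_bcontfun (\<phi> \<omega>) \<theta>))) * ennreal (\<Delta> N powr q)"
        by (rule iv(2)[OF N s1 s2 _ \<phi>]) (use T in simp)
      finally show "moment M p (\<lambda>\<omega>. x s \<phi> t \<omega> - X N s \<phi> t \<omega>) \<le> ennreal (C T)
          * (1 + (SUP \<theta>\<in>{-\<tau>..0}. moment M r (\<lambda>\<omega>. apply_bcontfun (\<phi> \<omega>) \<theta>))) * ennreal (\<Delta> N powr q)"
        by simp
    qed (use \<tau> t in auto)
    also have "\<dots> \<le> ennreal (C T) * (1 + ennreal M\<^sub>1) * ennreal (\<Delta> N powr q)"
    proof (intro mult_right_mono mult_left_mono add_left_mono SUP_least)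
      fix \<theta> assume \<theta>: "\<theta> \<in> {-\<tau>..0}"
      have "moment M r (\<lambda>\<omega>. apply_bcontfun (\<eta> \<omega>) \<theta>) = moment M r (X N 0 \<xi> (s + \<theta>))"
        using \<theta> by (intro moment_cong_AE AE_I2) (simp add: \<eta>_eval)
      also have "\<dots> \<le> ennreal M\<^sub>1" using ii(2)[OF N] \<theta> s0 by simp
      finally show "moment M r (\<lambda>\<omega>. apply_bcontfun (\<eta> \<omega>) \<theta>) \<le> ennreal M\<^sub>1" .
    qed auto
    also have "\<dots> = ennreal (C T * (1 + M\<^sub>1) * \<Delta> N powr q)"
      using ii(1) iv(1)[of T] by (simp add: ennreal_mult flip: ennreal_plus ennreal_1)
    finally have second: "moment M p (\<lambda>\<omega>. x s \<eta> t \<omega> - X N s \<eta> t \<omega>) \<le> ennreal (C T * (1 + M\<^sub>1) * \<Delta> N powr q)" .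

    have [measurable]: "x s \<zeta> t \<in> borel_measurable M" "x s \<eta> t \<in> borel_measurable M"
      using unique_sdde_solution_measurable[OF F s0 less_imp_le[OF t(1)] x] \<zeta> \<eta> by auto
    have [measurable]: "X N s \<eta> t \<in> borel_measurable M"
      using numerical_solution_measurable[OF F i(1)[OF N] \<Delta>(1,2), of \<eta> k1 t] \<eta> s1 t by simp
    have "moment M p (Z N t) = moment M p (\<lambda>\<omega>. (x s \<zeta> t \<omega> - x s \<eta> t \<omega>) + (x s \<eta> t \<omega> - X N s \<eta> t \<omega>))"
      using x_flow X_flow
    proof (intro moment_cong_AE, eventually_elim)
      case (elim \<omega>) then show ?case using t \<tau> by (simp add: Z_def)
    qed
    also have "\<dots> \<le> ennreal (2 powr p) * (moment M p (\<lambda>\<omega>. x s \<zeta> t \<omega> - x s \<eta> t \<omega>)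
        + moment M p (\<lambda>\<omega>. x s \<eta> t \<omega> - X N s \<eta> t \<omega>))"
      using p by (intro moment_add_le) auto
    also have "\<dots> \<le> ennreal (2 powr p) * (ennreal (M\<^sub>2 * exp (- M\<^sub>3 * (t - s)) * e)
        + ennreal (C T * (1 + M\<^sub>1) * \<Delta> N powr q))"
      by (intro mult_left_mono add_mono first second) simp
    also have "\<dots> = ennreal (2 powr p * (M\<^sub>2 * exp (- M\<^sub>3 * (t - s)) * e + C T * (1 + M\<^sub>1) * \<Delta> N powr q))"
      using e(2) iii(1) ii(1) iv(1)[of T] by (subst ennreal_mult) (simp_all add: ennreal_plus)
    also have "2 powr p * (M\<^sub>2 * exp (- M\<^sub>3 * (t - s)) * e + C T * (1 + M\<^sub>1) * \<Delta> N powr q)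
        = 2 powr p * M\<^sub>2 * exp (- M\<^sub>3 * (t - s)) * e + b * \<Delta> N powr q"
      by (simp add: b_def algebra_simps)
    finally show ?thesis .
  qed

  \<comment> \<open>With \<open>d = b * \<Delta> N powr q\<close>, the bound \<open>2 * d\<close> is
    the fixed point of the recursion that sends \<open>e\<close> to \<open>e/2 + d\<close>.\<close>
  have bound: "E N (real k * T) \<le> ennreal (2 * b * \<Delta> N powr q)" if N: "N \<ge> 1" for N k
  proof (induction k)
    case 0
    show ?case unfolding E_def by (rule SUP_least) (use zero[OF N] in simp)
  next
    case (Suc k)
    show ?case unfolding E_def
    proof (rule SUP_least)
      fix \<theta> assume \<theta>: "\<theta> \<in> {-\<tau>..0}"
      let ?t = "real (Suc k) * T + \<theta>" and ?s = "real k * T"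
      \<comment> \<open>The elapsed time \<open>T + \<theta>\<close> is at least
        \<open>T - \<tau>\<close>, so \<open>half\<close> applies.\<close>
      have h: "?t - ?s = T + \<theta>" by (simp add: algebra_simps)
      have "moment M p (Z N ?t) \<le> ennreal (2 powr p * M\<^sub>2 * exp (- M\<^sub>3 * (?t - ?s)) * (2 * b * \<Delta> N powr q) + b * \<Delta> N powr q)"
        by (rule step[OF N refl _ _ Suc]) (use h \<theta> T b in auto)
      also have "\<dots> \<le> ennreal (1/2 * (2 * b * \<Delta> N powr q) + b * \<Delta> N powr q)"
        using b \<theta> unfolding h by (intro ennreal_leI add_right_mono mult_right_mono half) auto
      finally show "moment M p (Z N ?t) \<le> ennreal (2 * b * \<Delta> N powr q)"
        by (simp add: mult.assoc)
    qed
  qed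

  \<comment> \<open>One more step from the last block boundary, without decay. The summand 1 ensures
    positivity when \<open>b = 0\<close>.\<close>
  define \<K> where "\<K> = 2 powr p * M\<^sub>2 * (2 * b) + b + 1"
  have "0 < \<K>" using b iii(1) by (simp add: \<K>_def add_nonneg_pos)
  moreover have "moment M p (Z N t) \<le> ennreal (\<K> * \<Delta> N powr q)" if N: "N \<ge> 1" and t: "t \<ge> -\<tau>" for N t
  proof (cases "t \<le> 0")
    case True
    then show ?thesis using zero[OF N, of t] t by simp
  next
    case False
    \<comment> \<open>A ceiling minus one, not a floor: the block has to start strictly before
      \<open>t\<close>, because \<open>step\<close> and the numerical flow property require
      it.\<close>
    define k where "k = nat (\<lceil>t / T\<rceil> - 1)"
    have "0 < t / T" using False T by simp
    then have k: "real k = of_int \<lceil>t / T\<rceil> - 1" by (simp add: k_def)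
    have "real k < t / T" "t / T \<le> real k + 1" unfolding k by linarith+
    then have kt: "real k * T < t" "t \<le> real k * T + T" using T by (simp_all add: field_simps)
    have "exp (- M\<^sub>3 * (t - real k * T)) \<le> 1" using kt iii(2) by simp
    then have le: "2 powr p * M\<^sub>2 * exp (- M\<^sub>3 * (t - real k * T)) \<le> 2 powr p * M\<^sub>2 * 1"
      using iii(1) by (intro mult_left_mono) auto
    have "moment M p (Z N t) \<le> ennreal (2 powr p * M\<^sub>2 * exp (- M\<^sub>3 * (t - real k * T)) * (2 * b * \<Delta> N powr q) + b * \<Delta> N powr q)"
      by (rule step[OF N refl kt bound[OF N]]) (use b in simp)
    also have "\<dots> \<le> ennreal (2 powr p * M\<^sub>2 * 1 * (2 * b * \<Delta> N powr q) + b * \<Delta> N powr q)"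
      using b by (intro ennreal_leI add_right_mono mult_right_mono le) auto
    also have "\<dots> \<le> ennreal (\<K> * \<Delta> N powr q)"
      by (intro ennreal_leI) (simp add: \<K>_def algebra_simps)
    finally show ?thesis .
  qed
  ultimately show ?thesis unfolding Z_def[abs_def] by blast
qed

end
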